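(* Let $G\subseteq \mathrm{GL}(n,\mathbb{R})$ be a linear Lie group and let $u:\mathbb{R}\to \mathrm{Lie}(G)$ be an admissible input for the system $$\dot X = X u,\qquad Y = X,\qquad X\in G .$$ Let $a_0>0$ and consider the passive observer $$\dot{\hat X} = \hat X u - a_0 \hat X \log(Y^{-1}\hat X),$$ with right-invariant error $E_r := \hat X X^{-1}$. Then, for $E_r(0)\in B(I_n,1)$, the passive observer exponentially stabilizes $E_r = I_n$. Furthermore, suppose that $u$ is such that for every initial condition $X(0)\in G$ the corresponding solution $X(t)$ is bounded. Then for $\hat X(0)\in G$ sufficiently close to $X(0)$ (i.e. for every $X(0)\in G$ there is $\varepsilon>0$ such that the following holds whenever $\|\hat X(0)-X(0)\|<\varepsilon$), the estimate satisfies $\hat X(t)\in G$ for $t\ge 0$ and $\hat X(t)\to X(t)$ exponentially as $t\to\infty$.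
   Context: A linear Lie group $G$ is a closed subgroup of $\mathrm{GL}(n,\mathbb{R})$; its Lie algebra is $\mathrm{Lie}(G)=\{A\in\mathbb{R}^{n\times n} : \exp(tA)\in G \text{ for all } t\in\mathbb{R}\}$. $\|\cdot\|$ is the matrix norm induced by the Euclidean norm, $I_n$ is the identity matrix and $B(A,r)=\{X\in\mathbb{R}^{n\times n}:\|A-X\|<r\}$. For a real matrix $X$ with no eigenvalue in $(-\infty,0]$, $\log(X)$ is the principal logarithm: the unique real $A$ with $\exp(A)=X$ whose eigenvalues all lie in $\{z\in\mathbb{C}:-\pi<\mathrm{Im}(z)<\pi\}$; for $X\in B(I_n,1)$ it equals $\sum_{k\ge1}\frac{(-1)^{k+1}}{k}(X-I_n)^k$. An input $u$ is admissible if for every $X(0)\in G$ the solution of $\dot X = Xu$ is unique, continuously differentiable and exists for all time. "For $E_r(0)\in B(I_n,1)$ the observer exponentially stabilizes $E_r=I_n$" means that $I_n$ is a locally exponentially stable equilibrium of the resulting dynamics of $E_r$ and that every solution with $E_r(0)\in B(I_n,1)$ converges exponentially to $I_n$. A matrix-valued function $Z(t)$ converges exponentially to $W(t)$ as $t\to\infty$ if there are $m,\alpha>0$ with $\|Z(t)-W(t)\|\le m e^{-\alpha t}$ for all $t\ge 0$. *)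

theory Defs
  imports "HOL-Analysis.Analysis"
begin

text \<open>The norm of the type \<open>real ^ 'n ^ 'n\<close> is the Frobenius norm; the induced norm is the
  operator norm below.\<close>

definition opnorm :: "real ^ 'n ^ 'n \<Rightarrow> real" where
  "opnorm A = onorm (\<lambda>x. A *v x)"

definition opball :: "real ^ 'n ^ 'n \<Rightarrow> real \<Rightarrow> (real ^ 'n ^ 'n) set" where
  "opball A r = {X. opnorm (A - X) < r}"

text \<open>The class operations \<open>*\<close>, \<open>^\<close> and \<open>1\<close> on \<open>real ^ 'n ^ 'n\<close> are componentwise, hence the
  explicit powers with respect to \<open>**\<close>.\<close>

primrec matpow :: "real ^ 'n ^ 'n \<Rightarrow> nat \<Rightarrow> real ^ 'n ^ 'n" where
  "matpow A 0 = mat 1"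
| "matpow A (Suc k) = A ** matpow A k"

definition mexp :: "real ^ 'n ^ 'n \<Rightarrow> real ^ 'n ^ 'n" where
  "mexp A = (\<Sum>k. (1 / fact k) *\<^sub>R matpow A k)"

definition eigenvalues :: "real ^ 'n ^ 'n \<Rightarrow> complex set" where
  "eigenvalues A = {z. \<exists>v. v \<noteq> 0 \<and> map_matrix complex_of_real A *v v = z *s v}"

definition mlog_domain :: "(real ^ 'n ^ 'n) set" where
  "mlog_domain = {X. eigenvalues X \<inter> \<real>\<^sub>\<le>\<^sub>0 = {}}"

text \<open>Only meaningful for arguments in \<open>mlog_domain\<close>.\<close>

definition mlog :: "real ^ 'n ^ 'n \<Rightarrow> real ^ 'n ^ 'n" where
  "mlog X = (THE A. mexp A = X \<and> (\<forall>z \<in> eigenvalues A. - pi < Im z \<and> Im z < pi))"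

definition linear_lie_group :: "(real ^ 'n ^ 'n) set \<Rightarrow> bool" where
  "linear_lie_group G \<longleftrightarrow>
     closedin (top_of_set {A. invertible A}) G \<and>
     mat 1 \<in> G \<and> (\<forall>A\<in>G. \<forall>B\<in>G. A ** B \<in> G) \<and> (\<forall>A\<in>G. matrix_inv A \<in> G)"

definition lie_algebra :: "(real ^ 'n ^ 'n) set \<Rightarrow> (real ^ 'n ^ 'n) set" where
  "lie_algebra G = {A. \<forall>t. mexp (t *\<^sub>R A) \<in> G}"

definition plant_solution ::
  "(real ^ 'n ^ 'n) set \<Rightarrow> (real \<Rightarrow> real ^ 'n ^ 'n) \<Rightarrow> (real \<Rightarrow> real ^ 'n ^ 'n) \<Rightarrow> bool" where
  "plant_solution G u X \<longleftrightarrow>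
     (\<forall>t. X t \<in> G \<and> (X has_vector_derivative X t ** u t) (at t))"

definition admissible :: "(real ^ 'n ^ 'n) set \<Rightarrow> (real \<Rightarrow> real ^ 'n ^ 'n) \<Rightarrow> bool" where
  "admissible G u \<longleftrightarrow>
     (\<forall>X0\<in>G. (\<exists>!X. plant_solution G u X \<and> X 0 = X0) \<and>
        (\<forall>X. plant_solution G u X \<and> X 0 = X0 \<longrightarrow> X C1_differentiable_on UNIV))"

text \<open>\<open>Xh\<close> solves the observer equation on the interval \<open>J\<close>, driven by the output \<open>Y = X\<close>. The
  observer state is an arbitrary matrix for which the logarithm is defined; it is not required
  to lie in the group.\<close>

definition observer_solution ::
  "real \<Rightarrow> (real \<Rightarrow> real ^ 'n ^ 'n) \<Rightarrow> (real \<Rightarrow> real ^ 'n ^ 'n) \<Rightarrow> real set \<Rightarrow>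
     (real \<Rightarrow> real ^ 'n ^ 'n) \<Rightarrow> bool" where
  "observer_solution a0 u X J Xh \<longleftrightarrow>
     (\<forall>t\<in>J. matrix_inv (X t) ** Xh t \<in> mlog_domain \<and>
        (Xh has_vector_derivative
           Xh t ** u t - a0 *\<^sub>R (Xh t ** mlog (matrix_inv (X t) ** Xh t))) (at t within J))"

text \<open>The dynamics of the right-invariant error: its trajectories are those of
  \<open>Xh X\<^sup>-\<^sup>1\<close>.\<close>

definition error_solution ::
  "real \<Rightarrow> (real \<Rightarrow> real ^ 'n ^ 'n) \<Rightarrow> (real \<Rightarrow> real ^ 'n ^ 'n) \<Rightarrow> real set \<Rightarrow>
     (real \<Rightarrow> real ^ 'n ^ 'n) \<Rightarrow> bool" where
  "error_solution a0 u X J E \<longleftrightarrow>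
     (\<exists>Xh. observer_solution a0 u X J Xh \<and> (\<forall>t\<in>J. E t = Xh t ** matrix_inv (X t)))"

text \<open>\<open>Z\<close> exists for all times from \<open>t0\<close> on, and every solution with the same value at \<open>t0\<close>, on
  whatever interval it is defined, is a restriction of \<open>Z\<close>. A claim about \<open>Z\<close> is then a claim
  about every solution with this initial value.\<close>

definition unique_solution_from ::
  "(real set \<Rightarrow> (real \<Rightarrow> real ^ 'n ^ 'n) \<Rightarrow> bool) \<Rightarrow> real \<Rightarrow> (real \<Rightarrow> real ^ 'n ^ 'n) \<Rightarrow> bool" where
  "unique_solution_from sol t0 Z \<longleftrightarrow>
     sol {t0..} Z \<and>
     (\<forall>J Z'. is_interval J \<and> t0 \<in> J \<and> J \<subseteq> {t0..} \<and> sol J Z' \<and> Z' t0 = Z t0 \<longrightarrow>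
        (\<forall>t\<in>J. Z' t = Z t))"

definition converges_exponentially ::
  "(real \<Rightarrow> real ^ 'n ^ 'n) \<Rightarrow> (real \<Rightarrow> real ^ 'n ^ 'n) \<Rightarrow> bool" where
  "converges_exponentially Z W \<longleftrightarrow>
     (\<exists>m>0. \<exists>\<alpha>>0. \<forall>t\<ge>0. opnorm (Z t - W t) \<le> m * exp (- \<alpha> * t))"

text \<open>The constants are uniform in the plant trajectory and in the initial time, as for a
  (possibly time-varying) error dynamics.\<close>

definition error_locally_exp_stable ::
  "(real ^ 'n ^ 'n) set \<Rightarrow> real \<Rightarrow> (real \<Rightarrow> real ^ 'n ^ 'n) \<Rightarrow> real ^ 'n ^ 'n \<Rightarrow> bool" where
  "error_locally_exp_stable G a0 u W \<longleftrightarrow>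
     (\<forall>X. plant_solution G u X \<longrightarrow> error_solution a0 u X {0..} (\<lambda>_. W)) \<and>
     (\<exists>\<delta>>0. \<exists>m>0. \<exists>\<alpha>>0. \<forall>X. plant_solution G u X \<longrightarrow>
        (\<forall>t0\<ge>0. \<forall>E0\<in>opball W \<delta>. \<exists>E. E t0 = E0 \<and>
           unique_solution_from (error_solution a0 u X) t0 E \<and>
           (\<forall>t\<ge>t0. opnorm (E t - W) \<le> m * exp (- \<alpha> * (t - t0)) * opnorm (E0 - W))))"

definition exponentially_stabilizes_error ::
  "(real ^ 'n ^ 'n) set \<Rightarrow> real \<Rightarrow> (real \<Rightarrow> real ^ 'n ^ 'n) \<Rightarrow> (real ^ 'n ^ 'n) set \<Rightarrow>
     real ^ 'n ^ 'n \<Rightarrow> bool" where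
  "exponentially_stabilizes_error G a0 u U W \<longleftrightarrow>
     error_locally_exp_stable G a0 u W \<and>
     (\<forall>X. plant_solution G u X \<longrightarrow>
        (\<forall>E0\<in>U. \<exists>E. E 0 = E0 \<and> unique_solution_from (error_solution a0 u X) 0 E \<and>
           converges_exponentially E (\<lambda>_. W)))"

end

theory Submission
  imports Defs "HOL-Computational_Algebra.Fundamental_Theorem_Algebra"
begin

text \<open>Substituting \<open>Xh = E X\<close> in the observer equation, and using that the principal logarithm
  commutes with conjugation, removes the plant from the error dynamics: the right-invariant error
  satisfies the autonomous equation \<open>E' = - a E log E\<close>. Along the curve
  \<open>E t = exp (exp (- a (t - t0)) log E0)\<close> the logarithm decays like \<open>exp (- a (t - t0))\<close>, and the curve
  solves the equation as long as the exponent is the principal logarithm of \<open>E t\<close>.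

  Write \<open>E0 = 1 - Z\<close> with \<open>r = norm Z < 1\<close>. The curve consists of the powers \<open>(1 - Z)\<^sup>s\<close>,
  \<open>0 < s \<le> 1\<close>. In the binomial series of \<open>1 - (1 - Z)\<^sup>s\<close> all coefficients of the powers of \<open>Z\<close> are
  nonnegative, so its norm is at most \<open>1 - (1 - r)\<^sup>s \<le> min r (s r / (1 - r))\<close>
  (\<open>norm_one_minus_power_le\<close>, \<open>one_minus_powr_bounds\<close>). This single estimate keeps the error in the
  ball where it started, gives the exponential rate, and bounds the eigenvalues of the logarithm.

  Matrices with the operator norm form a Banach algebra, \<open>matop\<close>, in which the power series for
  the exponential, for \<open>log (1 - Z)\<close> and for \<open>(1 - Z)\<^sup>s\<close> are available. That the logarithmic series is
  the value of \<open>mlog\<close>, a definite description, needs a uniqueness theorem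
  (\<open>principal_log_unique\<close>): a principal logarithm \<open>B\<close> of \<open>1 - Z\<close> commutes with \<open>Z\<close>, hence with
  \<open>L = log (1 - Z)\<close>, so that \<open>exp (B - L) = 1\<close>; if \<open>B \<noteq> L\<close>, a common eigenvector of \<open>B\<close> and \<open>L\<close>
  would exhibit eigenvalues differing by a nonzero multiple of \<open>2 \<pi> \<i>\<close>, which does not fit into
  the strip.

  Solutions are unique because \<open>E log E\<close> is Lipschitz on smaller balls and the known solution never
  leaves the ball of radius \<open>r\<close>: a competitor would have to reach a larger radius before it could
  separate from it (\<open>error_flow_unique\<close>).

  For the estimate to stay in \<open>G\<close>, the fractional powers of \<open>E0 \<in> G\<close> have to lie in \<open>G\<close>. Near the
  identity they do, because there the logarithm maps the closed group \<open>G\<close> into its Lie algebra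
  (\<open>log_in_lie_algebra\<close>, the core of the closed subgroup theorem). Boundedness of the plant
  trajectory then turns the convergence of \<open>E\<close> to the identity into convergence of \<open>E X\<close> to \<open>X\<close>.\<close>

section \<open>Logarithm and real powers near the unit of a Banach algebra\<close>

lemma has_vector_derivative_iff_Lim:
  "(f has_vector_derivative D) (at x within S) \<longleftrightarrow>
    ((\<lambda>y. (f y - f x) /\<^sub>R (y - x)) \<longlongrightarrow> D) (at x within S)"
proof -
  have *: "norm (((f y - f x) - (y - x) *\<^sub>R D) /\<^sub>R norm (y - x)) = norm ((f y - f x) /\<^sub>R (y - x) - D)"
    if "y \<noteq> x" for y
  proof -
    have "(f y - f x) /\<^sub>R (y - x) - D = ((f y - f x) - (y - x) *\<^sub>R D) /\<^sub>R (y - x)"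
      using that by (simp add: scaleR_diff_right)
    then show ?thesis by simp
  qed
  have "(f has_vector_derivative D) (at x within S) \<longleftrightarrow>
      ((\<lambda>y. ((f y - f x) - (y - x) *\<^sub>R D) /\<^sub>R norm (y - x)) \<longlongrightarrow> 0) (at x within S)"
    by (simp add: has_vector_derivative_def has_derivative_at_within bounded_linear_scaleR_left)
  also have "\<dots> \<longleftrightarrow> ((\<lambda>y. norm ((f y - f x) /\<^sub>R (y - x) - D)) \<longlongrightarrow> 0) (at x within S)"
    unfolding tendsto_norm_zero_iff[symmetric, of "\<lambda>y. ((f y - f x) - (y - x) *\<^sub>R D) /\<^sub>R norm (y - x)"]
    by (intro filterlim_cong refl eventually_at_filter[THEN iffD2] always_eventually allI impI *)
  also have "\<dots> \<longleftrightarrow> ((\<lambda>y. (f y - f x) /\<^sub>R (y - x)) \<longlongrightarrow> D) (at x within S)"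
    by (simp add: tendsto_norm_zero_iff LIM_zero_iff)
  finally show ?thesis .
qed

text \<open>The Mercator series of \<open>log (1 - Z)\<close>.\<close>
definition log_one_minus :: "'a::{real_normed_algebra_1,banach} \<Rightarrow> 'a" where
  "log_one_minus Z = - (\<Sum>k. Z ^ Suc k /\<^sub>R real (Suc k))"

text \<open>The binomial series of \<open>(1 - Z)\<^sup>s\<close>.\<close>
definition binomial_power :: "real \<Rightarrow> 'a::{real_normed_algebra_1,banach} \<Rightarrow> 'a" where
  "binomial_power s Z = (\<Sum>k. (s gchoose k) *\<^sub>R (- Z) ^ k)"

lemma gbinomial_step: "(s::real) gchoose Suc (Suc k) = (s gchoose Suc k) * (s - real (Suc k)) / real (Suc (Suc k))"
  using gbinomial_mult_1[of s "Suc k"] by (simp add: field_simps)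

lemma gbinomial_abs_le:
  fixes s :: real
  assumes "\<bar>s\<bar> \<le> 1"
  shows "\<bar>s gchoose Suc k\<bar> \<le> \<bar>s\<bar>"
proof (induction k)
  case (Suc k)
  have "\<bar>s - real (Suc k)\<bar> \<le> real (Suc (Suc k))" using assms by auto
  then have "\<bar>s gchoose Suc k\<bar> * (\<bar>s - real (Suc k)\<bar> / real (Suc (Suc k))) \<le> \<bar>s\<bar> * 1"
    by (intro mult_mono Suc.IH) auto
  then show ?case by (simp add: gbinomial_step abs_mult)
qed simp

text \<open>The recursion multiplies by \<open>(s - (k + 1)) / (k + 2) \<le> 0\<close>, so the signs alternate; this makes
  the coefficients of \<open>1 - (1 - Z)\<^sup>s\<close> nonnegative.\<close>
lemma gbinomial_sign:
  fixes s :: real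
  assumes "0 \<le> s" "s \<le> 1"
  shows "0 \<le> (-1) ^ k * (s gchoose Suc k)"
proof (induction k)
  case (Suc k)
  have "0 \<le> ((-1) ^ k * (s gchoose Suc k)) * ((real (Suc k) - s) / real (Suc (Suc k)))"
    using assms by (intro mult_nonneg_nonneg[OF Suc.IH] divide_nonneg_nonneg) auto
  also have "\<dots> = (-1) ^ Suc k * (s gchoose Suc (Suc k))"
    by (simp add: gbinomial_step field_simps)
  finally show ?case .
qed (use assms in simp)

lemma summable_gbinomial_abs:
  fixes s r :: real
  assumes "0 \<le> r" "r < 1"
  shows "summable (\<lambda>k. \<bar>s gchoose k\<bar> * r ^ k)"
proof -
  have "summable (\<lambda>k. norm ((s gchoose k) * r ^ k))"
    by (rule abs_summable_in_conv_radius) (use assms in \<open>auto simp: conv_radius_gchoose\<close>)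
  then show ?thesis using assms by (simp add: abs_mult)
qed

lemma norm_gbinomial_term_le:
  fixes Z :: "'a::{real_normed_algebra_1,banach}"
  shows "norm ((s gchoose k) *\<^sub>R (- Z) ^ k) \<le> \<bar>s gchoose k\<bar> * norm Z ^ k"
  using norm_power_ineq[of "- Z" k] by (simp add: mult_left_mono)

lemma summable_binomial_power_norm:
  fixes Z :: "'a::{real_normed_algebra_1,banach}"
  assumes "norm Z < 1"
  shows "summable (\<lambda>k. norm ((s gchoose k) *\<^sub>R (- Z) ^ k))"
  by (rule summable_comparison_test[OF _ summable_gbinomial_abs[of "norm Z" s]])
     (use assms norm_gbinomial_term_le[of s _ Z] in auto)

text \<open>Vandermonde's identity is the statement that the Cauchy product of two binomial series is the
  binomial series of the sum of the exponents.\<close>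
lemma binomial_power_add:
  fixes Z :: "'a::{real_normed_algebra_1,banach}"
  assumes "norm Z < 1"
  shows "binomial_power (s + t) Z = binomial_power s Z * binomial_power t Z"
proof -
  have "binomial_power s Z * binomial_power t Z =
      (\<Sum>k. \<Sum>i\<le>k. ((s gchoose i) *\<^sub>R (- Z) ^ i) * ((t gchoose (k - i)) *\<^sub>R (- Z) ^ (k - i)))"
    unfolding binomial_power_def by (intro Cauchy_product summable_binomial_power_norm assms)
  also have "\<dots> = (\<Sum>k. ((s + t) gchoose k) *\<^sub>R (- Z) ^ k)"
  proof (rule suminf_cong)
    fix k
    have "(\<Sum>i\<le>k. ((s gchoose i) *\<^sub>R (- Z) ^ i) * ((t gchoose (k - i)) *\<^sub>R (- Z) ^ (k - i)))
        = (\<Sum>i\<le>k. ((s gchoose i) * (t gchoose (k - i))) *\<^sub>R (- Z) ^ k)"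
      by (rule sum.cong) (auto simp: mult.commute simp flip: power_add)
    also have "\<dots> = ((s + t) gchoose k) *\<^sub>R (- Z) ^ k"
      using gbinomial_Vandermonde[of s t k] by (simp add: atMost_atLeast0 flip: scaleR_sum_left)
    finally show "(\<Sum>i\<le>k. ((s gchoose i) *\<^sub>R (- Z) ^ i) * ((t gchoose (k - i)) *\<^sub>R (- Z) ^ (k - i)))
        = ((s + t) gchoose k) *\<^sub>R (- Z) ^ k" .
  qed
  finally show ?thesis by (simp add: binomial_power_def)
qed

lemma binomial_power_0 [simp]: "binomial_power 0 Z = 1"
proof -
  have "binomial_power 0 Z = (\<Sum>k\<in>{0}. ((0::real) gchoose k) *\<^sub>R (- Z) ^ k)"
    unfolding binomial_power_def by (rule suminf_finite) (auto simp: gbinomial_0_left)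
  then show ?thesis by simp
qed

lemma binomial_power_1: "binomial_power 1 Z = 1 - Z"
proof -
  have "binomial_power 1 Z = (\<Sum>k\<in>{0,1}. ((1::real) gchoose k) *\<^sub>R (- Z) ^ k)"
    unfolding binomial_power_def
  proof (rule suminf_finite)
    fix k :: nat assume "k \<notin> {0,1}"
    then have "(1 choose k) = 0" by (intro binomial_eq_0) auto
    moreover have "(1::real) gchoose k = real (1 choose k)"
      by (simp only: binomial_gbinomial of_nat_1)
    ultimately show "((1::real) gchoose k) *\<^sub>R (- Z) ^ k = 0" by simp
  qed simp
  then show ?thesis by simp
qed

lemma binomial_power_split:
  fixes Z :: "'a::{real_normed_algebra_1,banach}"
  assumes "norm Z < 1"
  shows "binomial_power s Z = 1 + (\<Sum>k. (s gchoose Suc k) *\<^sub>R (- Z) ^ Suc k)"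
  using suminf_split_head[OF summable_norm_cancel[OF summable_binomial_power_norm[OF assms, of s]]]
  by (simp add: binomial_power_def algebra_simps)

lemma gbinomial_div_tendsto:
  "((\<lambda>h::real. (h gchoose Suc k) / h) \<longlongrightarrow> (-1) ^ k / real (Suc k)) (at 0)"
proof (induction k)
  case 0
  have "\<forall>\<^sub>F h::real in at 0. 1 = (h gchoose Suc 0) / h"
    by (auto simp: eventually_at_filter)
  then have "((\<lambda>h::real. (h gchoose Suc 0) / h) \<longlongrightarrow> 1) (at 0)"
    by (rule Lim_transform_eventually[OF tendsto_const])
  then show ?case by simp
next
  case (Suc k)
  have "((\<lambda>h::real. (h gchoose Suc k) / h * ((h - real (Suc k)) / real (Suc (Suc k)))) \<longlongrightarrow>
      (-1) ^ k / real (Suc k) * ((0 - real (Suc k)) / real (Suc (Suc k)))) (at 0)"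
    by (intro tendsto_intros Suc.IH) auto
  then show ?case by (simp add: gbinomial_step field_simps del: of_nat_Suc)
qed

lemma summable_log_one_minus:
  fixes Z :: "'a::{real_normed_algebra_1,banach}"
  assumes Z: "norm Z < 1"
  shows "summable (\<lambda>k. Z ^ Suc k /\<^sub>R real (Suc k))"
proof (rule summable_comparison_test)
  have "norm (Z ^ Suc k /\<^sub>R real (Suc k)) \<le> norm Z ^ Suc k" for k
  proof -
    have "inverse (real (Suc k)) * norm (Z ^ Suc k) \<le> 1 * norm Z ^ Suc k"
      by (intro mult_mono norm_power_ineq) (auto simp: field_simps)
    then show ?thesis by simp
  qed
  then show "\<exists>N. \<forall>n\<ge>N. norm (Z ^ Suc n /\<^sub>R real (Suc n)) \<le> norm Z ^ Suc n" by blast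
  show "summable (\<lambda>k. norm Z ^ Suc k)"
    using Z by (simp add: summable_Suc_iff[of "\<lambda>k. norm Z ^ k"] summable_geometric)
qed

text \<open>Only the derivative at \<open>s = 0\<close> is computed from the series, where the difference quotients
  of the coefficients are bounded by 1 and Tannery's theorem applies. The semigroup property
  transports it to all exponents.\<close>
lemma binomial_power_has_derivative_0:
  fixes Z :: "'a::{real_normed_algebra_1,banach}"
  assumes Z: "norm Z < 1"
  shows "((\<lambda>h. (binomial_power h Z - 1) /\<^sub>R h) \<longlongrightarrow> log_one_minus Z) (at 0)"
proof -
  let ?a = "\<lambda>k h. ((h gchoose Suc k) / h) *\<^sub>R (- Z) ^ Suc k"
  let ?b = "\<lambda>k. ((-1) ^ k / real (Suc k)) *\<^sub>R (- Z) ^ Suc k"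
  have "((\<lambda>h. \<Sum>k. ?a k h) \<longlongrightarrow> (\<Sum>k. ?b k)) (at (0::real))"
  proof (rule tannerys_theorem[THEN conjunct2, THEN conjunct2])
    show "((\<lambda>h. ?a k h) \<longlongrightarrow> ?b k) (at 0)" for k
      by (intro tendsto_intros gbinomial_div_tendsto)
    have "\<forall>\<^sub>F h::real in at 0. \<bar>h\<bar> \<le> 1 \<and> h \<noteq> 0"
      unfolding eventually_at by (rule exI[of _ 1]) auto
    then have "\<forall>\<^sub>F h::real in at 0. \<forall>k. norm (?a k h) \<le> norm Z ^ Suc k"
    proof eventually_elim
      case (elim h)
      show ?case
      proof
        fix k
        have "\<bar>(h gchoose Suc k) / h\<bar> \<le> 1"
          using gbinomial_abs_le[of h k] elim by (auto simp: field_simps)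
        then have "\<bar>(h gchoose Suc k) / h\<bar> * norm ((- Z) ^ Suc k) \<le> 1 * norm Z ^ Suc k"
          using norm_power_ineq[of "- Z" "Suc k"] by (intro mult_mono) auto
        then show "norm (?a k h) \<le> norm Z ^ Suc k" by simp
      qed
    qed
    then show "\<forall>\<^sub>F (k, h) in at_top \<times>\<^sub>F at (0::real). norm (?a k h) \<le> norm Z ^ Suc k"
      unfolding eventually_prod_filter
      by (intro exI[of _ "\<lambda>_. True"] exI[of _ "\<lambda>h. \<forall>k. norm (?a k h) \<le> norm Z ^ Suc k"]) auto
    show "summable (\<lambda>k. norm Z ^ Suc k)"
      using Z by (simp add: summable_Suc_iff[of "\<lambda>k. norm Z ^ k"] summable_geometric)
  qed simp
  moreover have "(\<Sum>k. ?b k) = log_one_minus Z"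
  proof -
    have *: "?b k = - (Z ^ Suc k /\<^sub>R real (Suc k))" for k
      by (auto simp: power_minus[of Z "Suc k"] divide_inverse minus_one_power_iff)
    show ?thesis unfolding log_one_minus_def * by (rule suminf_minus[OF summable_log_one_minus[OF Z]])
  qed
  moreover have "(\<Sum>k. ?a k h) = (binomial_power h Z - 1) /\<^sub>R h" for h
  proof -
    have s: "summable (\<lambda>k. (h gchoose Suc k) *\<^sub>R (- Z) ^ Suc k)"
      using summable_norm_cancel[OF summable_binomial_power_norm[OF Z, of h]]
      by (subst summable_Suc_iff)
    have "(\<Sum>k. ?a k h) = (\<Sum>k. ((h gchoose Suc k) *\<^sub>R (- Z) ^ Suc k) /\<^sub>R h)"
      by (simp add: divide_inverse mult.commute)
    also have "\<dots> = (\<Sum>k. (h gchoose Suc k) *\<^sub>R (- Z) ^ Suc k) /\<^sub>R h"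
      using suminf_scaleR_right[OF s, of "inverse h"] by simp
    finally show ?thesis by (simp add: binomial_power_split[OF Z])
  qed
  ultimately show ?thesis by simp
qed

lemma binomial_power_has_vector_derivative:
  fixes Z :: "'a::{real_normed_algebra_1,banach}"
  assumes Z: "norm Z < 1"
  shows "((\<lambda>s. binomial_power s Z) has_vector_derivative binomial_power s Z * log_one_minus Z) (at s)"
proof -
  have "((\<lambda>h. binomial_power s Z * ((binomial_power h Z - 1) /\<^sub>R h)) \<longlongrightarrow> binomial_power s Z * log_one_minus Z) (at 0)"
    by (intro tendsto_intros binomial_power_has_derivative_0 Z)
  moreover have "binomial_power s Z * ((binomial_power h Z - 1) /\<^sub>R h) = (binomial_power (s + h) Z - binomial_power s Z) /\<^sub>R (s + h - s)" for h
    by (simp add: binomial_power_add[OF Z] right_diff_distrib)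
  ultimately have "((\<lambda>h. (binomial_power (s + h) Z - binomial_power s Z) /\<^sub>R (s + h - s)) \<longlongrightarrow> binomial_power s Z * log_one_minus Z) (at 0)"
    by (simp only:)
  from LIM_offset_zero_cancel[OF this] show ?thesis
    by (simp add: has_vector_derivative_iff_Lim)
qed

text \<open>Both sides are semigroups in \<open>s\<close> with the same generator. The case \<open>s = 1\<close> says that
  the Mercator series inverts the exponential.\<close>
lemma binomial_power_eq_exp:
  fixes Z :: "'a::{real_normed_algebra_1,banach}"
  assumes Z: "norm Z < 1"
  shows "binomial_power s Z = exp (s *\<^sub>R log_one_minus Z)"
proof -
  let ?L = "log_one_minus Z"
  let ?f = "\<lambda>s. binomial_power s Z * exp (s *\<^sub>R (- ?L))"
  have "(?f has_vector_derivative 0) (at s within UNIV)" for s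
  proof -
    have "(?f has_vector_derivative binomial_power s Z * (- ?L * exp (s *\<^sub>R (- ?L))) +
        (binomial_power s Z * ?L) * exp (s *\<^sub>R (- ?L))) (at s)"
      by (intro has_vector_derivative_mult binomial_power_has_vector_derivative[OF Z]
            exp_scaleR_has_vector_derivative_left)
    then show ?thesis by (simp add: mult.assoc)
  qed
  then obtain c where c: "\<And>s. ?f s = c"
    using has_vector_derivative_zero_constant[of UNIV ?f] by auto
  have "c = 1" using c[of 0] by simp
  then have "binomial_power s Z * (exp (s *\<^sub>R (- ?L)) * exp (s *\<^sub>R ?L)) = exp (s *\<^sub>R ?L)"
    using c[of s] by (simp add: mult.assoc[symmetric])
  then show ?thesis using exp_minus_inverse[of "- (s *\<^sub>R ?L)"] by simp
qed

lemma exp_log_one_minus: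
  fixes Z :: "'a::{real_normed_algebra_1,banach}"
  assumes "norm Z < 1"
  shows "exp (log_one_minus Z) = 1 - Z"
  using binomial_power_eq_exp[OF assms, of 1] by (simp add: binomial_power_1)

text \<open>The coefficients of \<open>1 - (1 - Z)\<^sup>s\<close> are nonnegative, so the triangle inequality majorises the
  series by the same series in \<open>norm Z\<close>.\<close>
lemma norm_one_minus_power_le:
  fixes Z :: "'a::{real_normed_algebra_1,banach}"
  assumes Z: "norm Z < 1" and s: "0 \<le> s" "s \<le> 1"
  shows "norm (1 - exp (s *\<^sub>R log_one_minus Z)) \<le> 1 - (1 - norm Z) powr s"
proof -
  let ?r = "norm Z"
  let ?c = "\<lambda>k. - ((s gchoose Suc k) * (- ?r) ^ Suc k)"
  have c: "\<bar>s gchoose Suc k\<bar> * ?r ^ Suc k = ?c k" for k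
  proof -
    have "\<bar>s gchoose Suc k\<bar> = \<bar>(-1) ^ k * (s gchoose Suc k)\<bar>"
      by (simp add: abs_mult)
    also have "\<dots> = (-1) ^ k * (s gchoose Suc k)"
      using gbinomial_sign[OF s] by simp
    finally show ?thesis by (simp add: power_minus[of ?r k])
  qed
  have sums: "(\<lambda>k. (s gchoose k) * (- ?r) ^ k) sums (1 - ?r) powr s"
    using gen_binomial_real[of "- ?r" s] Z by simp
  have "(\<lambda>k. (s gchoose Suc k) * (- ?r) ^ Suc k) sums ((1 - ?r) powr s - 1)"
    using sums_Suc_iff[of "\<lambda>k. (s gchoose k) * (- ?r) ^ k"] sums by simp
  then have cs: "?c sums (1 - (1 - ?r) powr s)"
    using sums_minus by fastforce
  have bd: "norm ((s gchoose Suc k) *\<^sub>R (- Z) ^ Suc k) \<le> ?c k" for k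
    using norm_gbinomial_term_le[of s "Suc k" Z] unfolding c .
  have "norm (1 - exp (s *\<^sub>R log_one_minus Z)) = norm (\<Sum>k. (s gchoose Suc k) *\<^sub>R (- Z) ^ Suc k)"
    using binomial_power_split[OF Z, of s] by (simp add: binomial_power_eq_exp[OF Z])
  also have "\<dots> \<le> suminf ?c"
    by (rule norm_suminf_le[OF bd sums_summable[OF cs]])
  also have "\<dots> = 1 - (1 - ?r) powr s" using cs by (simp add: sums_iff)
  finally show ?thesis .
qed

text \<open>Telescoping instead of differentiating, as \<open>Z\<close> and \<open>W\<close> need not commute.\<close>
lemma norm_power_diff_le:
  fixes Z W :: "'a::real_normed_algebra_1"
  assumes "norm Z \<le> \<rho>" "norm W \<le> \<rho>"
  shows "norm (Z ^ Suc k - W ^ Suc k) \<le> real (Suc k) * \<rho> ^ k * norm (Z - W)"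
proof (induction k)
  case (Suc k)
  have \<rho>: "0 \<le> \<rho>" using assms(1) norm_ge_zero[of Z] by linarith
  have Wk: "norm (W ^ Suc k) \<le> \<rho> ^ Suc k"
    using norm_power_ineq[of W "Suc k"] power_mono[OF assms(2), of "Suc k"] by simp
  have "Z ^ Suc (Suc k) - W ^ Suc (Suc k) = Z * (Z ^ Suc k - W ^ Suc k) + (Z - W) * W ^ Suc k"
    by (simp add: algebra_simps)
  also have "norm \<dots> \<le> norm Z * norm (Z ^ Suc k - W ^ Suc k) + norm (Z - W) * norm (W ^ Suc k)"
    by (intro order_trans[OF norm_triangle_ineq] add_mono norm_mult_ineq)
  also have "\<dots> \<le> \<rho> * (real (Suc k) * \<rho> ^ k * norm (Z - W)) + norm (Z - W) * \<rho> ^ Suc k"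
    using \<rho> by (intro add_mono mult_mono assms Suc.IH Wk) auto
  finally show ?case by (simp add: algebra_simps)
qed simp

lemma log_one_minus_lipschitz:
  fixes Z W :: "'a::{real_normed_algebra_1,banach}"
  assumes Z: "norm Z \<le> \<rho>" "norm W \<le> \<rho>" and \<rho>: "\<rho> < 1"
  shows "norm (log_one_minus Z - log_one_minus W) \<le> norm (Z - W) / (1 - \<rho>)"
proof -
  have \<rho>0: "0 \<le> \<rho>" using assms(1) norm_ge_zero[of Z] by linarith
  note sZ = summable_log_one_minus[of Z] and sW = summable_log_one_minus[of W]
  have "log_one_minus W - log_one_minus Z = (\<Sum>k. Z ^ Suc k /\<^sub>R real (Suc k) - W ^ Suc k /\<^sub>R real (Suc k))"
    using sZ sW assms by (simp add: log_one_minus_def suminf_diff)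
  also have "\<dots> = (\<Sum>k. (Z ^ Suc k - W ^ Suc k) /\<^sub>R real (Suc k))"
    by (simp add: scaleR_diff_right)
  also have "norm \<dots> \<le> (\<Sum>k. \<rho> ^ k * norm (Z - W))"
  proof (rule norm_suminf_le)
    fix k
    have "inverse (real (Suc k)) * norm (Z ^ Suc k - W ^ Suc k)
        \<le> inverse (real (Suc k)) * (real (Suc k) * \<rho> ^ k * norm (Z - W))"
      by (intro mult_left_mono norm_power_diff_le Z) auto
    also have "\<dots> = \<rho> ^ k * norm (Z - W)"
      by simp
    finally show "norm ((Z ^ Suc k - W ^ Suc k) /\<^sub>R real (Suc k)) \<le> \<rho> ^ k * norm (Z - W)"
      by (simp only: norm_scaleR abs_inverse abs_of_nat)
    show "summable (\<lambda>k. \<rho> ^ k * norm (Z - W))"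
      using \<rho> \<rho>0 by (intro summable_mult2 summable_geometric) auto
  qed
  also have "\<dots> = norm (Z - W) / (1 - \<rho>)"
    using \<rho> \<rho>0 by (simp add: suminf_geometric summable_geometric flip: suminf_mult2)
  finally show ?thesis by (simp add: norm_minus_commute)
qed

lemma log_one_minus_0 [simp]: "log_one_minus 0 = 0"
  by (simp add: log_one_minus_def)

lemma log_one_minus_commute:
  fixes Z B :: "'a::{real_normed_algebra_1,banach}"
  assumes Z: "norm Z < 1" and B: "B * Z = Z * B"
  shows "B * log_one_minus Z = log_one_minus Z * B"
proof -
  note s = summable_log_one_minus[OF Z]
  have "B * Z ^ Suc k = Z ^ Suc k * B" for k
    using B power_commuting_commutes by metis
  then show ?thesis
    unfolding log_one_minus_def using suminf_mult[OF s, of B] suminf_mult2[OF s, of B] by simp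
qed

section \<open>The Banach algebra of real square matrices\<close>

text \<open>A copy of the square matrices is needed since on \<open>real ^ 'n ^ 'n\<close> the class multiplication
  is componentwise and the class norm is the Frobenius norm, in which the identity does not have
  norm 1. On the copy the class operations are the matrix product and the operator norm, so that the
  general theory of the exponential in Banach algebras applies.\<close>
typedef ('n::finite) matop = "UNIV :: (real ^ 'n ^ 'n) set"
  morphisms mat_of op_of by simp

lemmas op_of_mat [simp] = mat_of_inverse
lemma mat_of_op [simp]: "mat_of (op_of A) = A" by (simp add: op_of_inverse)
lemma matop_eq_iff: "A = B \<longleftrightarrow> mat_of A = mat_of B" by (simp add: mat_of_inject)

lemma opnorm_le: "(\<And>x. norm (A *v x) \<le> b * norm x) \<Longrightarrow> opnorm A \<le> b"
  unfolding opnorm_def by (rule onorm_le)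

lemma norm_le_opnorm: "norm (A *v x) \<le> opnorm A * norm x"
  unfolding opnorm_def by (rule onorm) simp

lemma opnorm_nonneg: "0 \<le> opnorm A"
  unfolding opnorm_def by (rule onorm_pos_le) simp

lemma opnorm_mult: "opnorm (A ** B) \<le> opnorm A * opnorm B"
proof (rule opnorm_le)
  fix x
  have "norm (A *v (B *v x)) \<le> opnorm A * (opnorm B * norm x)"
    by (rule order_trans[OF norm_le_opnorm mult_left_mono[OF norm_le_opnorm opnorm_nonneg]])
  then show "norm ((A ** B) *v x) \<le> opnorm A * opnorm B * norm x"
    by (simp add: matrix_vector_mul_assoc mult.assoc)
qed

lemma opnorm_triangle: "opnorm (A + B) \<le> opnorm A + opnorm B"
  unfolding opnorm_def matrix_vector_mult_add_rdistrib by (rule onorm_triangle) simp_all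

lemma opnorm_scaleR: "opnorm (c *\<^sub>R A) = \<bar>c\<bar> * opnorm A"
proof -
  have "(*v) (c *\<^sub>R A) = (\<lambda>x. c *\<^sub>R (A *v x))"
    by (simp add: scaleR_matrix_vector_assoc fun_eq_iff)
  then show ?thesis by (simp add: opnorm_def onorm_scaleR)
qed

lemma opnorm_eq_0: "opnorm A = 0 \<longleftrightarrow> A = 0"
  unfolding opnorm_def by (subst onorm_eq_0) (auto simp: matrix_eq)

lemma opnorm_1: "opnorm (mat 1 :: real ^ 'n ^ 'n) = 1"
  using onorm_id[where 'a = "real ^ 'n"] by (simp add: opnorm_def)

lemma matrix_add_rdistrib: "(A + B) ** C = A ** C + B ** (C :: real ^ 'n ^ 'n)"
  by (simp add: matrix_matrix_mult_def vec_eq_iff algebra_simps sum.distrib)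

instantiation matop :: (finite) real_normed_algebra_1
begin
definition "0 = op_of (0 :: real ^ 'a ^ 'a)"
definition "1 = op_of (mat 1 :: real ^ 'a ^ 'a)"
definition "A + B = op_of (mat_of A + mat_of B)"
definition "A - B = op_of (mat_of A - mat_of B)"
definition "- A = op_of (- mat_of A)"
definition "A * B = op_of (mat_of A ** mat_of B)"
definition "c *\<^sub>R A = op_of (c *\<^sub>R mat_of A)"
definition "norm A = opnorm (mat_of A)"
definition dist_matop :: "'a matop \<Rightarrow> 'a matop \<Rightarrow> real" where "dist_matop A B = norm (A - B)"
definition sgn_matop :: "'a matop \<Rightarrow> 'a matop" where "sgn_matop A = op_of (mat_of A /\<^sub>R norm A)"
definition uniformity_matop :: "('a matop \<times> 'a matop) filter" where
  "uniformity_matop = (INF e\<in>{0<..}. principal {(x, y). dist x y < e})"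
definition open_matop :: "'a matop set \<Rightarrow> bool" where
  "open_matop S = (\<forall>x\<in>S. \<forall>\<^sub>F (x', y) in uniformity. x' = x \<longrightarrow> y \<in> S)"

lemmas matop_defs = zero_matop_def one_matop_def plus_matop_def minus_matop_def uminus_matop_def
  times_matop_def scaleR_matop_def norm_matop_def

instance
proof
  fix A B C :: "'a matop" and a b :: real
  show "A + B + C = A + (B + C)" "A + B = B + A" "0 + A = A" "- A + A = 0" "A - B = A + - B"
    "a *\<^sub>R (A + B) = a *\<^sub>R A + a *\<^sub>R B" "(a + b) *\<^sub>R A = a *\<^sub>R A + b *\<^sub>R A"
    "a *\<^sub>R b *\<^sub>R A = (a * b) *\<^sub>R A" "1 *\<^sub>R A = A"
    by (simp_all add: matop_defs matop_eq_iff algebra_simps)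
  show "A * B * C = A * (B * C)" "(A + B) * C = A * C + B * C" "A * (B + C) = A * B + A * C"
    "1 * A = A" "A * 1 = A" "a *\<^sub>R A * B = a *\<^sub>R (A * B)" "A * a *\<^sub>R B = a *\<^sub>R (A * B)"
    by (simp_all add: matop_defs matop_eq_iff matrix_mul_assoc matrix_add_ldistrib
        matrix_add_rdistrib matrix_scalar_ac flip: scalar_matrix_assoc)
  have "mat 1 \<noteq> (0 :: real ^ 'a ^ 'a)"
    using opnorm_1[where 'n='a] opnorm_eq_0[of "0 :: real ^ 'a ^ 'a"] by auto
  then show "(0::'a matop) \<noteq> 1"
    by (auto simp: matop_defs matop_eq_iff)
  show "dist A B = norm (A - B)" "sgn A = inverse (norm A) *\<^sub>R A"
    "(uniformity :: ('a matop \<times> 'a matop) filter) = (INF e\<in>{0<..}. principal {(x, y). dist x y < e})"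
    by (simp_all add: dist_matop_def sgn_matop_def uniformity_matop_def scaleR_matop_def)
  show "open S = (\<forall>x\<in>S. \<forall>\<^sub>F (x', y) in uniformity. x' = x \<longrightarrow> y \<in> S)" for S :: "'a matop set"
    by (simp add: open_matop_def)
  show "(norm A = 0) = (A = 0)" "norm (A + B) \<le> norm A + norm B" "norm (a *\<^sub>R A) = \<bar>a\<bar> * norm A"
    "norm (A * B) \<le> norm A * norm B" "norm (1::'a matop) = 1"
    by (simp_all add: matop_defs matop_eq_iff opnorm_eq_0 opnorm_triangle opnorm_scaleR opnorm_mult opnorm_1)
qed
end

lemma mat_of_simps [simp]:
  "mat_of 0 = 0" "mat_of 1 = mat 1" "mat_of (A + B) = mat_of A + mat_of B"
  "mat_of (A - B) = mat_of A - mat_of B" "mat_of (- A) = - mat_of A"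
  "mat_of (A * B) = mat_of A ** mat_of B" "mat_of (c *\<^sub>R A) = c *\<^sub>R mat_of A"
  by (simp_all add: matop_defs)

lemma norm_op_of: "norm (op_of A) = opnorm A"
  by (simp add: norm_matop_def)

lemma op_of_simps:
  "op_of 0 = 0" "op_of (mat 1) = 1" "op_of (X + Y) = op_of X + op_of Y"
  "op_of (X - Y) = op_of X - op_of Y" "op_of (- X) = - op_of X"
  "op_of (X ** Y) = op_of X * op_of Y" "op_of (c *\<^sub>R X) = c *\<^sub>R op_of X"
  by (simp_all add: matop_eq_iff)

lemma bounded_linear_op_of: "bounded_linear (op_of :: real ^ 'n ^ 'n \<Rightarrow> 'n::finite matop)"
  by (intro linear_conv_bounded_linear[THEN iffD1] linearI) (simp_all add: op_of_simps)

lemma bounded_linear_mat_of: "bounded_linear (mat_of :: 'n::finite matop \<Rightarrow> _)"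
proof (rule bounded_linear_intro)
  fix A :: "'n matop"
  have "norm (mat_of A) \<le> (\<Sum>i\<in>UNIV. norm (mat_of A $ i))"
    by (simp add: norm_vec_def L2_set_le_sum)
  also have "\<dots> \<le> (\<Sum>i\<in>(UNIV::'n set). \<Sum>j\<in>(UNIV::'n set). norm (mat_of A $ i $ j))"
    by (intro sum_mono) (simp add: norm_vec_def L2_set_le_sum)
  also have "\<dots> \<le> (\<Sum>i\<in>(UNIV::'n set). \<Sum>j\<in>(UNIV::'n set). norm A)"
    by (intro sum_mono) (simp add: norm_matop_def opnorm_def matrix_component_le_onorm)
  finally show "norm (mat_of A) \<le> norm A * (real CARD('n) * real CARD('n))" by (simp add: mult_ac)
qed simp_all

instance matop :: (finite) banach
proof
  fix X :: "nat \<Rightarrow> 'a matop"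
  assume "Cauchy X"
  then have "Cauchy (\<lambda>n. mat_of (X n))"
    by (rule bounded_linear.Cauchy[OF bounded_linear_mat_of])
  then obtain L where "(\<lambda>n. mat_of (X n)) \<longlonglongrightarrow> L"
    using Cauchy_convergent convergent_def by blast
  then have "(\<lambda>n. op_of (mat_of (X n))) \<longlonglongrightarrow> op_of L"
    by (rule bounded_linear.tendsto[OF bounded_linear_op_of])
  then show "convergent X" by (auto simp: convergent_def)
qed

lemma matpow_mat_of: "matpow (mat_of A) k = mat_of (A ^ k)"
  by (induction k) simp_all

lemma mexp_mat_of: "mexp (mat_of A) = mat_of (exp A)"
proof -
  have "mat_of (exp A) = (\<Sum>k. mat_of (A ^ k /\<^sub>R fact k))"
    unfolding exp_def
    by (rule bounded_linear.suminf[OF bounded_linear_mat_of])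
       (rule summable_norm_cancel[OF summable_norm_exp])
  then show ?thesis by (simp add: mexp_def matpow_mat_of divide_inverse)
qed

lemma mexp_eq_exp: "mexp A = mat_of (exp (op_of A))"
  using mexp_mat_of[of "op_of A"] by simp

section \<open>The action on complex vectors\<close>

text \<open>Eigenvalues are complex while the matrices are real; real matrices are let act on complex
  vectors, so that limits are only ever taken in the real algebra.\<close>
definition complex_act :: "'n::finite matop \<Rightarrow> complex ^ 'n \<Rightarrow> complex ^ 'n" where
  "complex_act A v = map_matrix complex_of_real (mat_of A) *v v"

lemma complex_act_nth: "complex_act A v $ i = (\<Sum>j\<in>UNIV. complex_of_real (mat_of A $ i $ j) * v $ j)"
  by (simp add: complex_act_def matrix_vector_mult_def)

lemma complex_act_simps:
  "complex_act (A + B) v = complex_act A v + complex_act B v" "complex_act (A - B) v = complex_act A v - complex_act B v"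
  "complex_act A (v + w) = complex_act A v + complex_act A w" "complex_act A (z *s v) = z *s complex_act A v"
  "complex_act (c *\<^sub>R A) v = c *\<^sub>R complex_act A v" "complex_act 1 v = v" "complex_act 0 v = 0" "complex_act A 0 = 0"
  by (simp_all add: complex_act_def matrix_vector_mult_def vec_eq_iff algebra_simps sum.distrib
      sum_subtractf sum_distrib_left scaleR_sum_right scaleR_conv_of_real[where 'a = complex] mat_def if_distrib
      if_distribR cong: if_cong)

lemma complex_act_mult: "complex_act (A * B) v = complex_act A (complex_act B v)"
proof -
  have "map_matrix complex_of_real (X ** Y) = map_matrix complex_of_real X ** map_matrix complex_of_real Y"
    for X Y :: "real ^ 'n ^ 'n"
    by (simp add: vec_eq_iff matrix_matrix_mult_def)
  note hom = this
  show ?thesis by (simp only: complex_act_def mat_of_simps hom matrix_vector_mul_assoc)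
qed

lemma norm_complex_vec:
  fixes v :: "complex ^ 'n"
  shows "(norm v)\<^sup>2 = (norm (\<chi> i. Re (v $ i)))\<^sup>2 + (norm (\<chi> i. Im (v $ i)))\<^sup>2"
  by (simp add: norm_vec_def L2_set_def sum_nonneg cmod_power2 sum.distrib)

text \<open>Real and imaginary parts are transformed separately, so complexification does not increase
  the operator norm.\<close>
lemma norm_complex_act_le: "norm (complex_act A v) \<le> norm A * norm v"
proof (rule power2_le_imp_le)
  let ?R = "\<chi> i. Re (v $ i)" and ?I = "\<chi> i. Im (v $ i)"
  have "(\<chi> i. Re (complex_act A v $ i)) = mat_of A *v ?R" "(\<chi> i. Im (complex_act A v $ i)) = mat_of A *v ?I"
    by (simp_all add: vec_eq_iff complex_act_nth matrix_vector_mult_def)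
  then have "(norm (complex_act A v))\<^sup>2 = (norm (mat_of A *v ?R))\<^sup>2 + (norm (mat_of A *v ?I))\<^sup>2"
    by (simp add: norm_complex_vec)
  also have "\<dots> \<le> (norm A * norm ?R)\<^sup>2 + (norm A * norm ?I)\<^sup>2"
    by (intro add_mono power_mono) (simp_all add: norm_matop_def norm_le_opnorm)
  also have "\<dots> = (norm A * norm v)\<^sup>2"
    by (simp add: power_mult_distrib norm_complex_vec[of v] algebra_simps)
  finally show "(norm (complex_act A v))\<^sup>2 \<le> (norm A * norm v)\<^sup>2" .
qed simp

lemma bounded_linear_complex_act: "bounded_linear (\<lambda>A. complex_act A v)"
  by (rule bounded_linear_intro[where K = "norm v"]) (simp_all add: complex_act_simps norm_complex_act_le)

lemma eigenvalues_iff: "z \<in> eigenvalues (mat_of A) \<longleftrightarrow> (\<exists>v. v \<noteq> 0 \<and> complex_act A v = z *s v)"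
  by (simp add: eigenvalues_def complex_act_def)

lemma norm_vector_smult: "norm (z *s v) = cmod z * norm (v :: complex ^ 'n)"
  by (simp add: norm_vec_def norm_mult L2_set_right_distrib)

lemma complex_act_power: "complex_act A v = z *s v \<Longrightarrow> complex_act (A ^ k) v = z ^ k *s v"
  by (induction k) (simp_all add: complex_act_simps complex_act_mult power_commutes mult.commute)

text \<open>Spectral mapping for power series on a single eigenvector.\<close>
lemma complex_act_series:
  fixes z :: complex
  assumes "complex_act A v = z *s v" "(\<lambda>k. c k *\<^sub>R A ^ k) sums S" "(\<lambda>k. c k *\<^sub>R z ^ k) sums s"
  shows "complex_act S v = s *s v"
proof -
  have "(\<lambda>k. complex_act (c k *\<^sub>R A ^ k) v) sums complex_act S v"
    by (rule bounded_linear.sums[OF bounded_linear_complex_act assms(2)])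
  moreover have "complex_act (c k *\<^sub>R A ^ k) v = (c k *\<^sub>R z ^ k) *s v" for k
    by (simp add: complex_act_simps complex_act_power[OF assms(1)] vec_eq_iff)
  moreover have "bounded_linear (\<lambda>z. z *s v)"
    by (rule bounded_linear_intro[where K = "norm v"])
       (simp_all add: norm_vector_smult vec_eq_iff algebra_simps)
  from bounded_linear.sums[OF this assms(3)] have "(\<lambda>k. (c k *\<^sub>R z ^ k) *s v) sums (s *s v)" .
  ultimately show ?thesis by (simp add: sums_unique2)
qed

lemma complex_act_exp:
  assumes "complex_act A v = z *s v"
  shows "complex_act (exp A) v = exp z *s v"
  by (rule complex_act_series[OF assms, where c = "\<lambda>k. inverse (fact k)"])
     (use exp_converges in \<open>auto simp: divide_inverse\<close>)

lemma eigenvalue_norm_le: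
  assumes "v \<noteq> 0" "complex_act A v = z *s v"
  shows "cmod z \<le> norm A"
  using norm_complex_act_le[of A v] assms by (simp add: norm_vector_smult)

section \<open>Eigenvectors in invariant subspaces\<close>

text \<open>Stated for an indexed family rather than a set, so that repetitions among the \<open>f i\<close> count as
  dependencies.\<close>
lemma powers_dependent:
  fixes f :: "nat \<Rightarrow> 'a::euclidean_space"
  shows "\<exists>c :: nat \<Rightarrow> real. (\<exists>i\<le>DIM('a). c i \<noteq> 0) \<and> (\<Sum>i\<le>DIM('a). c i *\<^sub>R f i) = 0"
proof (cases "inj_on f {..DIM('a)}")
  case True
  then have "card (f ` {..DIM('a)}) = Suc DIM('a)" by (simp add: card_image)
  then have "dependent (f ` {..DIM('a)})" by (intro dependent_biggerset) auto
  then obtain u where u: "\<exists>v\<in>f ` {..DIM('a)}. u v \<noteq> 0" "(\<Sum>v\<in>f ` {..DIM('a)}. u v *\<^sub>R v) = 0"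
    using dependent_finite[of "f ` {..DIM('a)}"] by auto
  then show ?thesis
    by (intro exI[of _ "u \<circ> f"]) (auto simp: sum.reindex[OF True])
next
  case False
  then obtain i j where ij: "i \<le> DIM('a)" "j \<le> DIM('a)" "i \<noteq> j" "f i = f j"
    by (auto simp: inj_on_def)
  define c :: "nat \<Rightarrow> real" where "c k = (if k = i then 1 else 0) - (if k = j then 1 else 0)" for k
  have "(\<Sum>k\<le>DIM('a). c k *\<^sub>R f k) =
      (\<Sum>k\<le>DIM('a). (if k = i then f k else 0)) - (\<Sum>k\<le>DIM('a). (if k = j then f k else 0))"
    unfolding sum_subtractf[symmetric] by (rule sum.cong) (auto simp: c_def)
  also have "\<dots> = 0" using ij by simp
  finally show ?thesis using ij by (intro exI[of _ c]) (auto simp: c_def intro!: exI[of _ i])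
qed

definition poly_act :: "(complex ^ 'n \<Rightarrow> complex ^ 'n) \<Rightarrow> complex poly \<Rightarrow> complex ^ 'n \<Rightarrow> complex ^ 'n" where
  "poly_act T p v = (\<Sum>i\<le>degree p. coeff p i *s (T ^^ i) v)"

lemma poly_act_bound:
  assumes "degree p \<le> N"
  shows "poly_act T p v = (\<Sum>i\<le>N. coeff p i *s (T ^^ i) v)"
  unfolding poly_act_def
  by (rule sum.mono_neutral_left) (use assms in \<open>auto simp: coeff_eq_0\<close>)

lemma poly_act_pCons:
  assumes add: "\<And>v w. T (v + w) = T v + T w" and scale: "\<And>z v. T (z *s v) = z *s T v"
  shows "poly_act T (pCons a p) v = a *s v + T (poly_act T p v)"
proof -
  have T0: "T 0 = 0" using scale[of 0 0] by simp
  have "T (\<Sum>i\<le>n. coeff p i *s (T ^^ i) v) = (\<Sum>i\<le>n. T (coeff p i *s (T ^^ i) v))" for n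
    by (induction n) (simp_all add: add)
  then have "T (poly_act T p v) = (\<Sum>i\<le>degree p. coeff p i *s (T ^^ Suc i) v)"
    by (simp add: poly_act_def scale)
  moreover have "poly_act T (pCons a p) v = (\<Sum>i\<le>Suc (degree p). coeff (pCons a p) i *s (T ^^ i) v)"
    by (rule poly_act_bound) (simp add: degree_pCons_le)
  ultimately show ?thesis by (simp add: sum.atMost_Suc_shift del: sum.atMost_Suc)
qed

lemma poly_act_diff:
  "poly_act T (p - q) v = poly_act T p v - poly_act T q v"
proof -
  let ?N = "max (degree p) (degree q)"
  have "poly_act T (p - q) v = (\<Sum>i\<le>?N. coeff (p - q) i *s (T ^^ i) v)"
    by (rule poly_act_bound) (simp add: degree_diff_le_max)
  moreover have "poly_act T p v = (\<Sum>i\<le>?N. coeff p i *s (T ^^ i) v)"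
    "poly_act T q v = (\<Sum>i\<le>?N. coeff q i *s (T ^^ i) v)"
    by (rule poly_act_bound; simp)+
  ultimately show ?thesis
    by (simp add: sum_subtractf[symmetric] vector_sub_rdistrib)
qed

lemma poly_act_smult: "poly_act T (smult a p) v = a *s poly_act T p v"
proof -
  have "poly_act T (smult a p) v = (\<Sum>i\<le>degree p. coeff (smult a p) i *s (T ^^ i) v)"
    by (rule poly_act_bound) (simp add: degree_smult_le)
  then show ?thesis
    by (simp add: poly_act_def vec.scale_sum_right)
qed

text \<open>The vectors \<open>v, T v, T\<^sup>2 v, \<dots>\<close> satisfy a polynomial relation \<open>p(T) v = 0\<close>. Splitting linear
  factors off \<open>p\<close> one at a time, the last nonzero \<open>q(T) v\<close> is an eigenvector, and it lies in every
  invariant subspace that contains \<open>v\<close>. Applied to an eigenspace of a commuting operator, this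
  yields common eigenvectors.\<close>
lemma invariant_subspace_eigenvector:
  fixes T :: "complex ^ 'n::finite \<Rightarrow> complex ^ 'n"
  assumes add: "\<And>v w. T (v + w) = T v + T w" and scale: "\<And>z v. T (z *s v) = z *s T v"
    and S: "vec.subspace S" and inv: "\<And>v. v \<in> S \<Longrightarrow> T v \<in> S" and v: "v \<in> S" "v \<noteq> 0"
  shows "\<exists>w\<in>S. w \<noteq> 0 \<and> (\<exists>z. T w = z *s w)"
proof -
  have pS: "poly_act T p v \<in> S" for p
  proof (induction p)
    case 0
    show ?case using vec.subspace_0[OF S] by (simp add: poly_act_def)
  next
    case (pCons a p)
    then show ?case
      unfolding poly_act_pCons[of T, OF add scale]
      by (intro vec.subspace_add[OF S] vec.subspace_scale[OF S] inv v)
  qed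
  let ?d = "DIM(complex ^ 'n)"
  obtain c :: "nat \<Rightarrow> real" where c: "\<exists>i\<le>?d. c i \<noteq> 0" "(\<Sum>i\<le>?d. c i *\<^sub>R (T ^^ i) v) = 0"
    using powers_dependent[of "\<lambda>i. (T ^^ i) v"] by blast
  define p where "p = (\<Sum>i\<le>?d. monom (complex_of_real (c i)) i)"
  have coeff: "coeff p i = (if i \<le> ?d then complex_of_real (c i) else 0)" for i
    by (simp add: p_def coeff_sum if_distrib cong: if_cong)
  have "degree p \<le> ?d" by (rule degree_le) (simp add: coeff)
  then have "poly_act T p v = (\<Sum>i\<le>?d. coeff p i *s (T ^^ i) v)" by (rule poly_act_bound)
  also have "\<dots> = (\<Sum>i\<le>?d. c i *\<^sub>R (T ^^ i) v)"
    by (rule sum.cong) (auto simp: coeff vec_eq_iff scaleR_conv_of_real[where 'a = complex])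
  finally have "poly_act T p v = 0" using c(2) by simp
  moreover have "p \<noteq> 0" using c(1) coeff by (metis coeff_0 of_real_eq_0_iff)
  ultimately show ?thesis
  proof (induction "degree p" arbitrary: p)
    case 0
    then obtain a where "p = [:a:]" using degree_eq_zeroE by metis
    with 0 v show ?case by (simp add: poly_act_def)
  next
    case (Suc n)
    then obtain z where "poly p z = 0"
      using fundamental_theorem_of_algebra[of p] by (auto simp: constant_degree)
    then obtain q where q: "p = [:- z, 1:] * q"
      by (auto simp: poly_eq_0_iff_dvd)
    have "q \<noteq> 0" using q Suc.prems by auto
    have "p = pCons 0 q - smult z q" using q by simp
    then have "poly_act T p v = T (poly_act T q v) - z *s poly_act T q v"
      by (simp only: poly_act_diff poly_act_smult poly_act_pCons[of T, OF add scale]) simp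
    then have Tq: "T (poly_act T q v) = z *s poly_act T q v" using Suc.prems by simp
    show ?case
    proof (cases "poly_act T q v = 0")
      case True
      have "degree p = degree [:- z, 1:] + degree q"
        unfolding q by (rule degree_mult_eq) (use \<open>q \<noteq> 0\<close> in auto)
      then have "degree p = Suc (degree q)" by simp
      then show ?thesis using Suc.hyps True \<open>q \<noteq> 0\<close> by simp
    next
      case False
      then show ?thesis using Tq pS[of q] by blast
    qed
  qed
qed

lemma complex_act_eigenvector:
  assumes "vec.subspace S" "\<And>v. v \<in> S \<Longrightarrow> complex_act A v \<in> S" "v \<in> S" "v \<noteq> 0"
  shows "\<exists>w\<in>S. w \<noteq> 0 \<and> (\<exists>z. complex_act A w = z *s w)"
  using assms by (intro invariant_subspace_eigenvector[where S = S]) (auto simp: complex_act_simps)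

section \<open>Uniqueness of the principal logarithm\<close>

text \<open>The entire function \<open>(exp x - 1) / x\<close>.\<close>
definition exp_quotient :: "'a::{real_normed_algebra_1,banach} \<Rightarrow> 'a" where
  "exp_quotient x = (\<Sum>k. x ^ k /\<^sub>R fact (Suc k))"

lemma exp_quotient_sums:
  fixes x :: "'a::{real_normed_algebra_1,banach}"
  shows "(\<lambda>k. x ^ k /\<^sub>R fact (Suc k)) sums exp_quotient x"
  unfolding exp_quotient_def
proof (rule summable_sums, rule summable_comparison_test)
  have "norm (x ^ n /\<^sub>R fact (Suc n)) \<le> norm x ^ n /\<^sub>R fact n" for n
  proof -
    have "inverse (fact (Suc n)) * norm (x ^ n) \<le> inverse (fact n) * norm x ^ n"
      by (intro mult_mono norm_power_ineq le_imp_inverse_le fact_mono) auto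
    then show ?thesis by (simp del: fact_Suc)
  qed
  then show "\<exists>N. \<forall>n\<ge>N. norm (x ^ n /\<^sub>R fact (Suc n)) \<le> norm x ^ n /\<^sub>R fact n" by blast
  show "summable (\<lambda>n. norm x ^ n /\<^sub>R fact n)" using exp_converges[of "norm x"] by (rule sums_summable)
qed

lemma mult_exp_quotient:
  fixes x :: "'a::{real_normed_algebra_1,banach}"
  shows "x * exp_quotient x = exp x - 1"
proof -
  have "(\<lambda>k. x ^ Suc k /\<^sub>R fact (Suc k)) sums (x * exp_quotient x)"
    using sums_mult[OF exp_quotient_sums, of x x] by (simp del: fact_Suc)
  moreover have "(\<lambda>k. x ^ Suc k /\<^sub>R fact (Suc k)) sums (exp x - 1)"
    using exp_converges[of x] sums_Suc_iff[of "\<lambda>k. x ^ k /\<^sub>R fact k"] by simp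
  ultimately show ?thesis by (rule sums_unique2)
qed

lemma exp_quotient_0: "exp_quotient 0 = (1::'a::{real_normed_algebra_1,banach})"
  unfolding exp_quotient_def by (subst suminf_finite[of "{0}"]) (auto simp: power_0_left)

lemma exp_quotient_zero_complex:
  fixes z :: complex
  assumes "exp_quotient z = 0"
  shows "\<exists>k::int. k \<noteq> 0 \<and> z = of_int (2 * k) * pi * \<i>"
proof -
  have "exp z = 1" using mult_exp_quotient[of z] assms by simp
  then obtain k :: int where k: "Re z = 0" "Im z = of_int (2 * k) * pi"
    by (auto simp: exp_eq_1)
  moreover have "z \<noteq> 0" using assms exp_quotient_0[where 'a = complex] by auto
  ultimately show ?thesis
    by (intro exI[of _ k]) (auto simp: complex_eq_iff)
qed

definition principal_strip :: "complex set" where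
  "principal_strip = {z. - pi < Im z \<and> Im z < pi}"

text \<open>With \<open>N = B - L\<close> one has \<open>0 = exp N - 1 = N h(N)\<close> for \<open>h = exp_quotient\<close>. If \<open>h(N)\<close> is
  invertible then \<open>N = 0\<close>. Otherwise its kernel contains an eigenvector of \<open>N\<close> for a zero of \<open>h\<close>,
  which is a nonzero multiple of \<open>2 \<pi> \<i>\<close>; inside this eigenspace \<open>B\<close> has an eigenvector, and it is
  an eigenvector of \<open>L\<close> too, so two points of the strip differ by at least \<open>2 \<pi>\<close> in height.
  Working with \<open>h\<close> instead of \<open>exp\<close> makes a Jordan decomposition of \<open>N\<close> superfluous.\<close>
lemma commuting_principal_logs_eq:
  fixes B L :: "'n::finite matop"
  assumes comm: "B * L = L * B" and e: "exp B = exp L"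
    and sB: "eigenvalues (mat_of B) \<subseteq> principal_strip"
    and sL: "eigenvalues (mat_of L) \<subseteq> principal_strip"
  shows "B = L"
proof -
  define N where "N = B - L"
  have NB: "N * B = B * N" using comm by (simp add: N_def algebra_simps)
  have "exp N = exp B * exp (- L)"
    using exp_add_commuting[of B "- L"] comm by (simp add: N_def)
  also have "\<dots> = 1" unfolding e by (rule exp_minus_inverse)
  finally have "exp N = 1" .
  then have Nh: "N * exp_quotient N = 0" by (simp add: mult_exp_quotient)
  show ?thesis
  proof (cases "\<exists>v. v \<noteq> 0 \<and> mat_of (exp_quotient N) *v v = 0")
    case False
    then obtain C where "C ** mat_of (exp_quotient N) = mat 1"
      using matrix_left_invertible_ker[of "mat_of (exp_quotient N)"] by blast
    then have "mat_of (exp_quotient N) ** C = mat 1" by (simp add: matrix_left_right_inverse)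
    then have "exp_quotient N * op_of C = 1" by (simp add: matop_eq_iff)
    then have "N = N * exp_quotient N * op_of C" by (simp add: mult.assoc)
    then have "N = 0" using Nh by simp
    then show ?thesis by (simp add: N_def)
  next
    case True
    then obtain v where v: "v \<noteq> 0" "mat_of (exp_quotient N) *v v = 0" by blast
    let ?S1 = "{x. complex_act (exp_quotient N) x = 0}"
    have sub1: "vec.subspace ?S1" by (auto simp: vec.subspace_def complex_act_simps)
    have cN: "N * exp_quotient N = exp_quotient N * N"
    proof -
      have "(\<lambda>k. N * (N ^ k /\<^sub>R fact (Suc k))) sums (N * exp_quotient N)"
        by (rule sums_mult[OF exp_quotient_sums])
      moreover have "(\<lambda>k. (N ^ k /\<^sub>R fact (Suc k)) * N) sums (exp_quotient N * N)"
        by (rule sums_mult2[OF exp_quotient_sums])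
      moreover have "(N ^ k /\<^sub>R fact (Suc k)) * N = N * (N ^ k /\<^sub>R fact (Suc k))" for k
        by (simp add: power_commutes del: fact_Suc)
      ultimately show ?thesis by (metis (no_types, lifting) sums_cong sums_unique2)
    qed
    have inv1: "complex_act N x \<in> ?S1" if "x \<in> ?S1" for x
      using that by (simp add: complex_act_mult[symmetric] cN[symmetric]) (simp add: complex_act_mult complex_act_simps)
    let ?v = "\<chi> i. complex_of_real (v $ i)"
    have "?v \<in> ?S1"
      using v(2) by (simp add: vec_eq_iff complex_act_nth matrix_vector_mult_def flip: of_real_mult of_real_sum)
    moreover have "?v \<noteq> 0" using v(1) by (auto simp: vec_eq_iff)
    ultimately obtain x \<mu> where x: "x \<in> ?S1" "x \<noteq> 0" "complex_act N x = \<mu> *s x"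
      using complex_act_eigenvector[OF sub1 inv1] by blast
    have "(\<lambda>k. inverse (fact (Suc k)) *\<^sub>R N ^ k) sums exp_quotient N"
      "(\<lambda>k. inverse (fact (Suc k)) *\<^sub>R \<mu> ^ k) sums exp_quotient \<mu>"
      by (rule exp_quotient_sums)+
    from complex_act_series[OF x(3) this] have "exp_quotient \<mu> *s x = 0" using x(1) by simp
    then have "exp_quotient \<mu> = 0" using x(2) by simp
    then obtain k :: int where k: "k \<noteq> 0" "\<mu> = of_int (2 * k) * pi * \<i>"
      using exp_quotient_zero_complex by blast
    let ?S2 = "{y. complex_act N y = \<mu> *s y}"
    have sub2: "vec.subspace ?S2"
      by (auto simp: vec.subspace_def complex_act_simps vector_add_ldistrib vec.scale_left_commute)
    have inv2: "complex_act B y \<in> ?S2" if "y \<in> ?S2" for y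
      using that by (simp add: complex_act_mult[symmetric] NB) (simp add: complex_act_mult complex_act_simps)
    obtain y \<beta> where y: "y \<in> ?S2" "y \<noteq> 0" "complex_act B y = \<beta> *s y"
      using complex_act_eigenvector[OF sub2 inv2, of x] x by blast
    have "L = B - N" by (simp add: N_def)
    then have "complex_act L y = (\<beta> - \<mu>) *s y"
      using y by (simp add: complex_act_simps vector_sub_rdistrib)
    then have "\<beta> \<in> principal_strip" "\<beta> - \<mu> \<in> principal_strip"
      using y sB sL eigenvalues_iff by blast+
    then have "\<bar>Im \<mu>\<bar> < 2 * pi" by (auto simp: principal_strip_def)
    moreover have "Im \<mu> = 2 * pi * of_int k" using k(2) by simp
    then have "\<bar>Im \<mu>\<bar> = 2 * pi * of_int \<bar>k\<bar>" by (simp add: abs_mult)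
    moreover have "1 \<le> real_of_int \<bar>k\<bar>" using k(1) by linarith
    then have "2 * pi * 1 \<le> 2 * pi * real_of_int \<bar>k\<bar>" by (intro mult_left_mono) auto
    ultimately have False by simp
    then show ?thesis ..
  qed
qed

text \<open>An eigenvalue \<open>z\<close> of the logarithm gives the eigenvalue \<open>exp (s z)\<close> of \<open>(1 - Z)\<^sup>s\<close>, which lies in
  the unit disc around 1 for all \<open>s\<close> between 0 and 1. Hence \<open>cos (s Im z)\<close> has no zero
  there, and the imaginary part of \<open>z\<close> stays even below \<open>\<pi> / 2\<close>.\<close>
lemma log_one_minus_eigenvalues:
  fixes Z :: "'n::finite matop"
  assumes Z: "norm Z < 1"
  shows "eigenvalues (mat_of (log_one_minus Z)) \<subseteq> principal_strip"
proof
  fix z assume "z \<in> eigenvalues (mat_of (log_one_minus Z))"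
  then obtain v where v: "v \<noteq> 0" "complex_act (log_one_minus Z) v = z *s v" by (auto simp: eigenvalues_iff)
  have pos: "0 < Re (exp (complex_of_real s * z))" if s: "0 \<le> s" "s \<le> 1" for s
  proof -
    have "complex_act (s *\<^sub>R log_one_minus Z) v = (complex_of_real s * z) *s v"
      by (simp add: complex_act_simps v vec_eq_iff scaleR_conv_of_real[where 'a = complex])
    from complex_act_exp[OF this]
    have "complex_act (1 - exp (s *\<^sub>R log_one_minus Z)) v = (1 - exp (complex_of_real s * z)) *s v"
      by (simp add: complex_act_simps vector_sub_rdistrib)
    then have "cmod (1 - exp (complex_of_real s * z)) \<le> norm (1 - exp (s *\<^sub>R log_one_minus Z))"
      by (rule eigenvalue_norm_le[OF v(1)])
    also have "\<dots> \<le> 1 - (1 - norm Z) powr s"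
      by (rule norm_one_minus_power_le[OF Z s])
    also have "\<dots> < 1" using Z by simp
    finally have "cmod (1 - exp (complex_of_real s * z)) < 1" .
    then show ?thesis using complex_Re_le_cmod[of "1 - exp (complex_of_real s * z)"] by simp
  qed
  have "\<bar>Im z\<bar> < pi / 2"
  proof (rule ccontr)
    assume "\<not> \<bar>Im z\<bar> < pi / 2"
    then have big: "pi / 2 \<le> \<bar>Im z\<bar>" by simp
    define s where "s = pi / 2 / \<bar>Im z\<bar>"
    have "0 < \<bar>Im z\<bar>" using big pi_gt_zero by linarith
    then have s: "0 \<le> s" "s \<le> 1" using big pi_gt_zero by (auto simp: s_def divide_le_eq)
    have "s * \<bar>Im z\<bar> = pi / 2" using \<open>0 < \<bar>Im z\<bar>\<close> by (simp add: s_def)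
    then have "\<bar>s * Im z\<bar> = pi / 2" using s(1) by (simp add: abs_mult)
    then have "cos (s * Im z) = 0" by (metis cos_abs_real cos_pi_half)
    then show False using pos[OF s] by (simp add: Re_exp)
  qed
  then show "z \<in> principal_strip" using pi_gt_zero by (auto simp: principal_strip_def)
qed

lemma principal_log_unique:
  fixes Z B :: "'n::finite matop"
  assumes Z: "norm Z < 1" and B: "exp B = 1 - Z" "eigenvalues (mat_of B) \<subseteq> principal_strip"
  shows "B = log_one_minus Z"
proof (rule commuting_principal_logs_eq)
  have "B * exp B = exp B * B" using exp_times_scaleR_commute[of 1 B] by simp
  then have "B * Z = Z * B" by (simp add: B algebra_simps)
  then show "B * log_one_minus Z = log_one_minus Z * B" by (rule log_one_minus_commute[OF Z])
qed (use B exp_log_one_minus[OF Z] log_one_minus_eigenvalues[OF Z] in auto)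

section \<open>The exponential near the origin\<close>

text \<open>The linear term is subtracted because this quantifies, without commutativity, that the
  derivative of the exponential at points near 0 is close to the identity.\<close>
lemma exp_minus_id_lipschitz:
  fixes X Y :: "'a::{real_normed_algebra_1,banach}"
  assumes "norm X \<le> \<rho>" "norm Y \<le> \<rho>"
  shows "norm ((exp X - X) - (exp Y - Y)) \<le> (exp \<rho> - 1) * norm (X - Y)"
proof -
  have shift: "(\<lambda>k. Z ^ Suc (Suc k) /\<^sub>R fact (Suc (Suc k))) sums (exp Z - 1 - Z)" for Z :: 'a
    using exp_converges[of Z] sums_Suc_iff[of "\<lambda>k. Z ^ k /\<^sub>R fact k"]
      sums_Suc_iff[of "\<lambda>k. Z ^ Suc k /\<^sub>R fact (Suc k)"] by simp
  let ?d = "\<lambda>k. (X ^ Suc (Suc k) - Y ^ Suc (Suc k)) /\<^sub>R fact (Suc (Suc k))"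
  have d: "?d sums ((exp X - X) - (exp Y - Y))"
    using sums_diff[OF shift[of X] shift[of Y]]
    by (simp add: scaleR_diff_right algebra_simps del: fact_Suc power_Suc)
  have e: "(\<lambda>k. \<rho> ^ Suc k /\<^sub>R fact (Suc k) * norm (X - Y)) sums ((exp \<rho> - 1) * norm (X - Y))"
    using exp_converges[of \<rho>] sums_Suc_iff[of "\<lambda>k. \<rho> ^ k /\<^sub>R fact k"]
    by (intro sums_mult2) simp
  have le: "norm (?d k) \<le> \<rho> ^ Suc k /\<^sub>R fact (Suc k) * norm (X - Y)" for k
  proof -
    have "norm (?d k) = inverse (fact (Suc (Suc k))) * norm (X ^ Suc (Suc k) - Y ^ Suc (Suc k))"
      by (simp del: fact_Suc power_Suc)
    also have "\<dots> \<le> inverse (fact (Suc (Suc k))) * (real (Suc (Suc k)) * \<rho> ^ Suc k * norm (X - Y))"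
      by (intro mult_left_mono norm_power_diff_le assms) simp
    also have "\<dots> = \<rho> ^ Suc k /\<^sub>R fact (Suc k) * norm (X - Y)"
      by (subst fact_Suc[of "Suc k"]) (simp add: field_simps del: fact_Suc of_nat_Suc power_Suc)
    finally show ?thesis .
  qed
  have "norm (suminf ?d) \<le> suminf (\<lambda>k. \<rho> ^ Suc k /\<^sub>R fact (Suc k) * norm (X - Y))"
    by (rule norm_suminf_le[OF le sums_summable[OF e]])
  then show ?thesis using d e by (simp only: sums_iff)
qed

lemma tendsto_exp_algebra:
  fixes f :: "'b \<Rightarrow> 'a::{real_normed_algebra_1,banach}"
  assumes f: "(f \<longlongrightarrow> L) F"
  shows "((\<lambda>x. exp (f x)) \<longlongrightarrow> exp L) F"
proof -
  let ?\<rho> = "norm L + 1"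
  have "((\<lambda>x. norm (f x)) \<longlongrightarrow> norm L) F" using f by (rule tendsto_norm)
  then have "\<forall>\<^sub>F x in F. norm (f x) < ?\<rho>" by (rule order_tendstoD) simp
  then have "\<forall>\<^sub>F x in F. norm ((exp (f x) - f x) - (exp L - L)) \<le> (exp ?\<rho> - 1) * norm (f x - L)"
    by eventually_elim (intro exp_minus_id_lipschitz, auto)
  moreover have "((\<lambda>x. (exp ?\<rho> - 1) * norm (f x - L)) \<longlongrightarrow> 0) F"
    by (intro tendsto_mult_right_zero tendsto_norm_zero LIM_zero f)
  ultimately have "((\<lambda>x. (exp (f x) - f x) - (exp L - L)) \<longlongrightarrow> 0) F"
    by (rule Lim_null_comparison)
  then have "((\<lambda>x. ((exp (f x) - f x) - (exp L - L)) + f x + (exp L - L)) \<longlongrightarrow> 0 + L + (exp L - L)) F"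
    by (intro tendsto_intros f)
  then show ?thesis by simp
qed

lemma exp_scaleR_of_nat:
  fixes x :: "'a::{real_normed_algebra_1,banach}"
  shows "exp (real n *\<^sub>R x) = exp x ^ n"
proof (induction n)
  case (Suc n)
  have "exp (real (Suc n) *\<^sub>R x) = exp (x + real n *\<^sub>R x)" by (simp add: algebra_simps)
  also have "\<dots> = exp x * exp (real n *\<^sub>R x)" by (rule exp_add_commuting) simp
  finally show ?case using Suc.IH by simp
qed simp

lemma log_one_minus_norm_le:
  fixes W :: "'a::{real_normed_algebra_1,banach}"
  assumes "norm W \<le> 1 / 2"
  shows "norm (log_one_minus W) \<le> 2 * norm W"
  using log_one_minus_lipschitz[of W "1/2" 0] assms by simp

text \<open>Since \<open>g k = exp L\<close> with \<open>L\<close> small, \<open>g k - 1\<close> and \<open>L\<close> agree to first order, so they have the same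
  limits after rescaling. This allows the limits below to be taken with group elements instead
  of their logarithms.\<close>
lemma log_difference_quotient:
  fixes g :: "nat \<Rightarrow> 'a::{real_normed_algebra_1,banach}"
  assumes l: "\<And>k. 0 < l k" "l \<longlonglongrightarrow> 0" and g: "(\<lambda>k. (g k - 1) /\<^sub>R l k) \<longlonglongrightarrow> A"
  shows "(\<lambda>k. log_one_minus (1 - g k) /\<^sub>R l k) \<longlonglongrightarrow> A" "\<forall>\<^sub>F k in sequentially. norm (1 - g k) < 1 / 2"
proof -
  let ?W = "\<lambda>k. 1 - g k" and ?L = "\<lambda>k. log_one_minus (1 - g k)"
  have "(\<lambda>k. - (l k *\<^sub>R ((g k - 1) /\<^sub>R l k))) \<longlonglongrightarrow> - (0 *\<^sub>R A)"
    by (intro tendsto_intros l g)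
  moreover have "- (l k *\<^sub>R ((g k - 1) /\<^sub>R l k)) = ?W k" for k
    using l(1)[of k] by simp
  ultimately have W: "?W \<longlonglongrightarrow> 0" by simp
  then have nW: "(\<lambda>k. norm (?W k)) \<longlonglongrightarrow> 0" by (rule tendsto_norm_zero)
  then show ev: "\<forall>\<^sub>F k in sequentially. norm (?W k) < 1 / 2" by (rule order_tendstoD) simp
  have bd: "\<forall>\<^sub>F k in sequentially. norm ((g k - 1) /\<^sub>R l k - ?L k /\<^sub>R l k)
      \<le> (exp (2 * norm (?W k)) - 1) * (2 * norm ((g k - 1) /\<^sub>R l k))"
    using ev
  proof eventually_elim
    case (elim k)
    have Lk: "norm (?L k) \<le> 2 * norm (?W k)" using log_one_minus_norm_le[of "?W k"] elim by simp
    have "exp (?L k) = g k" using exp_log_one_minus[of "?W k"] elim by simp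
    then have "norm (g k - 1 - ?L k) \<le> (exp (2 * norm (?W k)) - 1) * norm (?L k)"
      using exp_minus_id_lipschitz[of "?L k" "2 * norm (?W k)" 0] Lk by (simp add: algebra_simps)
    also have "\<dots> \<le> (exp (2 * norm (?W k)) - 1) * (2 * norm (?W k))"
      by (intro mult_left_mono Lk) simp
    finally have "inverse (l k) * norm (g k - 1 - ?L k) \<le>
        inverse (l k) * ((exp (2 * norm (?W k)) - 1) * (2 * norm (?W k)))"
      using l(1)[of k] by (intro mult_left_mono) auto
    moreover have "(g k - 1) /\<^sub>R l k - ?L k /\<^sub>R l k = (g k - 1 - ?L k) /\<^sub>R l k"
      by (simp add: scaleR_diff_right)
    moreover have "norm ((g k - 1 - ?L k) /\<^sub>R l k) = inverse (l k) * norm (g k - 1 - ?L k)"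
      using l(1)[of k] by simp
    moreover have "norm ((g k - 1) /\<^sub>R l k) = inverse (l k) * norm (?W k)"
      using l(1)[of k] by (simp add: norm_minus_commute)
    ultimately show ?case by (simp only: mult_ac)
  qed
  have "(\<lambda>k. (exp (2 * norm (?W k)) - 1) * (2 * norm ((g k - 1) /\<^sub>R l k))) \<longlonglongrightarrow>
      (exp (2 * 0) - 1) * (2 * norm A)"
    by (intro tendsto_intros nW g)
  then have "(\<lambda>k. (exp (2 * norm (?W k)) - 1) * (2 * norm ((g k - 1) /\<^sub>R l k))) \<longlonglongrightarrow> 0"
    by (simp only: mult_zero_right exp_zero diff_self mult_zero_left)
  from Lim_null_comparison[OF bd this]
  have "(\<lambda>k. (g k - 1) /\<^sub>R l k - ?L k /\<^sub>R l k) \<longlonglongrightarrow> 0" .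
  from tendsto_diff[OF g this] show "(\<lambda>k. ?L k /\<^sub>R l k) \<longlonglongrightarrow> A" by simp
qed

section \<open>One-parameter subgroups of a closed group\<close>

lemma matrix_inv_eqI:
  fixes A B :: "real ^ 'n ^ 'n"
  assumes "A ** B = mat 1" "B ** A = mat 1"
  shows "matrix_inv A = B"
proof -
  have "A ** matrix_inv A = mat 1 \<and> matrix_inv A ** A = mat 1"
    unfolding matrix_inv_def by (rule someI[of _ B]) (use assms in simp)
  then show ?thesis using assms by (metis matrix_mul_assoc matrix_mul_lid matrix_mul_rid)
qed

lemma mat_of_exp_inverse:
  "mat_of (exp A) ** mat_of (exp (- A)) = mat 1" "mat_of (exp (- A)) ** mat_of (exp A) = mat 1"
  using exp_minus_inverse[of A] exp_minus_inverse[of "- A"] by (simp_all add: matop_eq_iff)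

lemma lie_algebra_iff: "mat_of A \<in> lie_algebra G \<longleftrightarrow> (\<forall>t. mat_of (exp (t *\<^sub>R A)) \<in> G)"
  by (simp add: lie_algebra_def mexp_eq_exp op_of_simps)

context
  fixes G :: "(real ^ 'n::finite ^ 'n) set"
  assumes G: "linear_lie_group G"
begin

lemma group_mult: "mat_of a \<in> G \<Longrightarrow> mat_of b \<in> G \<Longrightarrow> mat_of (a * b) \<in> G"
  using G by (simp add: linear_lie_group_def)

lemma group_one: "mat_of 1 \<in> G"
  using G by (simp add: linear_lie_group_def)

lemma group_power: "mat_of a \<in> G \<Longrightarrow> mat_of (a ^ k) \<in> G"
proof (induction k)
  case 0
  then show ?case using group_one by simp
next
  case (Suc k)
  then show ?case using group_mult[of a "a ^ k"] by simp
qed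

lemma group_exp_minus:
  assumes "mat_of (exp A) \<in> G"
  shows "mat_of (exp (- A)) \<in> G"
proof -
  have "matrix_inv (mat_of (exp A)) = mat_of (exp (- A))"
    by (rule matrix_inv_eqI) (rule mat_of_exp_inverse)+
  then show ?thesis using G assms by (auto simp: linear_lie_group_def)
qed

text \<open>The group is closed only relative to the invertible matrices, so limits stay in it when they
  are exponentials.\<close>
lemma group_exp_limit:
  assumes g: "\<And>k. mat_of (g k) \<in> G" and lim: "g \<longlonglongrightarrow> exp A"
  shows "mat_of (exp A) \<in> G"
proof -
  obtain T where T: "closed T" "G = {A. invertible A} \<inter> T"
    using G by (auto simp: linear_lie_group_def closedin_closed)
  have "(\<lambda>k. mat_of (g k)) \<longlonglongrightarrow> mat_of (exp A)"
    by (rule bounded_linear.tendsto[OF bounded_linear_mat_of lim])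
  moreover have "mat_of (g k) \<in> T" for k using g T(2) by blast
  ultimately have "mat_of (exp A) \<in> T"
    using closed_sequentially[OF T(1), of "\<lambda>k. mat_of (g k)"] by simp
  moreover have "invertible (mat_of (exp A))"
    unfolding invertible_def using mat_of_exp_inverse by blast
  ultimately show ?thesis using T(2) by blast
qed

text \<open>A tangent direction of \<open>G\<close> at the identity belongs to the Lie algebra: \<open>exp (t A)\<close> is the limit
  of the powers \<open>(g k)\<^sup>m\<close> with \<open>m\<close> close to \<open>t / l k\<close>.\<close>
lemma lie_algebra_limit:
  assumes g: "\<And>k. mat_of (g k) \<in> G"
    and l: "\<And>k. 0 < l k" "l \<longlonglongrightarrow> 0" and lim: "(\<lambda>k. (g k - 1) /\<^sub>R l k) \<longlonglongrightarrow> A"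
  shows "mat_of A \<in> lie_algebra G"
proof -
  have pos: "mat_of (exp (t *\<^sub>R A)) \<in> G" if t: "0 \<le> t" for t
  proof -
    define m where "m k = nat \<lfloor>t / l k\<rfloor>" for k
    let ?L = "\<lambda>k. log_one_minus (1 - g k)"
    have m: "\<bar>real (m k) * l k - t\<bar> \<le> l k" for k
    proof -
      have "real (m k) = of_int \<lfloor>t / l k\<rfloor>" using t l(1)[of k] by (simp add: m_def)
      then have "real (m k) \<le> t / l k" "t / l k < real (m k) + 1"
        by linarith+
      then have "real (m k) * l k \<le> t" "t < (real (m k) + 1) * l k"
        using l(1)[of k] by (simp_all add: pos_le_divide_eq pos_divide_less_eq)
      then show ?thesis by (simp add: algebra_simps)
    qed
    have "(\<lambda>k. real (m k) * l k - t) \<longlonglongrightarrow> 0"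
      by (rule Lim_null_comparison[OF _ l(2)]) (use m in auto)
    then have "(\<lambda>k. real (m k) * l k) \<longlonglongrightarrow> t" by (rule LIM_zero_cancel)
    then have "(\<lambda>k. (real (m k) * l k) *\<^sub>R (?L k /\<^sub>R l k)) \<longlonglongrightarrow> t *\<^sub>R A"
      by (intro tendsto_intros log_difference_quotient(1)[OF l lim])
    moreover have "(real (m k) * l k) *\<^sub>R (?L k /\<^sub>R l k) = real (m k) *\<^sub>R ?L k" for k
      using l(1)[of k] by simp
    ultimately have "(\<lambda>k. real (m k) *\<^sub>R ?L k) \<longlonglongrightarrow> t *\<^sub>R A" by (simp only:)
    then have "(\<lambda>k. exp (real (m k) *\<^sub>R ?L k)) \<longlonglongrightarrow> exp (t *\<^sub>R A)"
      by (rule tendsto_exp_algebra)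
    moreover have "\<forall>\<^sub>F k in sequentially. exp (real (m k) *\<^sub>R ?L k) = g k ^ m k"
      using log_difference_quotient(2)[OF l lim]
      by eventually_elim (simp add: exp_scaleR_of_nat exp_log_one_minus)
    ultimately have "(\<lambda>k. g k ^ m k) \<longlonglongrightarrow> exp (t *\<^sub>R A)" by (rule Lim_transform_eventually)
    then show ?thesis by (intro group_exp_limit[of "\<lambda>k. g k ^ m k"] group_power g)
  qed
  have "mat_of (exp (t *\<^sub>R A)) \<in> G" for t
  proof (cases "0 \<le> t")
    case False
    then show ?thesis using group_exp_minus[OF pos[of "- t"]] by simp
  qed (rule pos)
  then show ?thesis by (simp add: lie_algebra_iff)
qed

text \<open>For sums, \<open>exp (s A) exp (s B)\<close> is a curve in \<open>G\<close> with tangent \<open>A + B\<close> at the identity.\<close>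
lemma subspace_lie_algebra: "subspace (lie_algebra G)"
proof (rule subspaceI)
  show "0 \<in> lie_algebra G"
    using lie_algebra_iff[of 0 G] group_one by simp
  show "c *\<^sub>R a \<in> lie_algebra G" if "a \<in> lie_algebra G" for c a
    using that by (simp add: lie_algebra_def)
  show "a + b \<in> lie_algebra G" if ab: "a \<in> lie_algebra G" "b \<in> lie_algebra G" for a b
  proof -
    let ?A = "op_of a" and ?B = "op_of b" and ?l = "\<lambda>k. inverse (real (Suc k))"
    let ?f = "\<lambda>s. exp (s *\<^sub>R ?A) * exp (s *\<^sub>R ?B)"
    have "(?f has_vector_derivative exp (0 *\<^sub>R ?A) * (exp (0 *\<^sub>R ?B) * ?B) +
        (exp (0 *\<^sub>R ?A) * ?A) * exp (0 *\<^sub>R ?B)) (at 0)"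
      by (intro has_vector_derivative_mult exp_scaleR_has_vector_derivative_right)
    then have "((\<lambda>s. (?f s - 1) /\<^sub>R s) \<longlongrightarrow> ?A + ?B) (at 0)"
      by (simp add: has_vector_derivative_iff_Lim add.commute)
    moreover have "filterlim ?l (at 0) sequentially"
      using LIMSEQ_inverse_real_of_nat by (rule filterlim_atI) simp
    ultimately have "(\<lambda>k. (?f (?l k) - 1) /\<^sub>R ?l k) \<longlonglongrightarrow> ?A + ?B"
      by (rule filterlim_compose)
    moreover have "mat_of (?f (?l k)) \<in> G" for k
      using ab lie_algebra_iff[of ?A G] lie_algebra_iff[of ?B G] by (intro group_mult) auto
    ultimately have "mat_of (?A + ?B) \<in> lie_algebra G"
      by (intro lie_algebra_limit[of "\<lambda>k. ?f (?l k)" ?l] LIMSEQ_inverse_real_of_nat) auto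
    then show ?thesis by simp
  qed
qed

text \<open>If not, there are group elements \<open>x k = exp (A k)\<close> converging to 1 with \<open>A k\<close> outside the Lie
  algebra. Split \<open>A k = S k + R k\<close> into a part in the Lie algebra and a nonzero part orthogonal to it.
  The elements \<open>exp (- S k) x k\<close> of \<open>G\<close> equal \<open>1 + R k\<close> up to an error that is small relative to \<open>R k\<close>,
  so the limit of a convergent subsequence of the normalised \<open>R k\<close> is a tangent direction, hence a
  unit vector in the Lie algebra that is orthogonal to it.\<close>
lemma log_in_lie_algebra:
  "\<exists>\<delta>>0. \<forall>x. mat_of x \<in> G \<and> norm (1 - x) < \<delta> \<longrightarrow> mat_of (log_one_minus (1 - x)) \<in> lie_algebra G"
proof (rule ccontr)
  assume neg: "\<not> ?thesis"
  let ?\<delta> = "\<lambda>k. inverse (real (Suc k)) / 2"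
  have "\<exists>x. mat_of x \<in> G \<and> norm (1 - x) < ?\<delta> k \<and> mat_of (log_one_minus (1 - x)) \<notin> lie_algebra G" for k
  proof -
    have "0 < ?\<delta> k" by simp
    then show ?thesis using neg by blast
  qed
  then obtain x where x: "\<And>k. mat_of (x k) \<in> G" "\<And>k. norm (1 - x k) < ?\<delta> k"
      "\<And>k. mat_of (log_one_minus (1 - x k)) \<notin> lie_algebra G"
    by metis
  define A where "A k = log_one_minus (1 - x k)" for k
  have x2: "norm (1 - x k) < 1 / 2" for k
    by (rule less_le_trans[OF x(2)]) (simp add: field_simps)
  have expA: "exp (A k) = x k" for k
    using exp_log_one_minus[of "1 - x k"] x2[of k] by (simp add: A_def)
  have nA: "norm (A k) \<le> inverse (real (Suc k))" for k
    using log_one_minus_norm_le[of "1 - x k"] x2[of k] x(2)[of k] by (simp add: A_def)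
  have A0: "A \<longlonglongrightarrow> 0"
    by (rule Lim_null_comparison[OF always_eventually LIMSEQ_inverse_real_of_nat]) (use nA in blast)
  have "\<exists>s r. s \<in> lie_algebra G \<and> (\<forall>w\<in>lie_algebra G. r \<bullet> w = 0) \<and> mat_of (A k) = s + r" for k
  proof -
    obtain y z where yz: "y \<in> span (lie_algebra G)" "\<And>w. w \<in> span (lie_algebra G) \<Longrightarrow> orthogonal z w"
        "mat_of (A k) = y + z"
      using orthogonal_subspace_decomp_exists[of "lie_algebra G" "mat_of (A k)"] by blast
    have "span (lie_algebra G) = lie_algebra G" by (simp add: subspace_lie_algebra)
    with yz show ?thesis by (intro exI[of _ y] exI[of _ z]) (auto simp: orthogonal_def)
  qed
  then obtain s r where sr: "\<And>k. s k \<in> lie_algebra G" "\<And>k w. w \<in> lie_algebra G \<Longrightarrow> r k \<bullet> w = 0"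
      "\<And>k. mat_of (A k) = s k + r k"
    by metis
  define S where "S k = op_of (s k)" for k
  define R where "R k = op_of (r k)" for k
  have ASR: "A k = S k + R k" for k
    by (simp add: matop_eq_iff S_def R_def sr(3))
  have r0: "r k \<noteq> 0" for k
    using sr(1,3)[of k] x(3)[of k] by (auto simp: A_def)
  have rA: "norm (r k) \<le> norm (mat_of (A k))" for k
  proof -
    have "r k \<bullet> r k = r k \<bullet> mat_of (A k)"
      using sr(2)[OF sr(1), of k k] by (simp add: sr(3) inner_add_right)
    also have "\<dots> \<le> norm (r k) * norm (mat_of (A k))" by (rule norm_cauchy_schwarz)
    also have "r k \<bullet> r k = norm (r k) * norm (r k)" by (metis dot_square_norm power2_eq_square)
    finally have "norm (r k) * norm (r k) \<le> norm (r k) * norm (mat_of (A k))" .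
    then show ?thesis using r0[of k] by simp
  qed
  have "(\<lambda>k. norm (mat_of (A k))) \<longlonglongrightarrow> 0"
    using tendsto_norm[OF bounded_linear.tendsto[OF bounded_linear_mat_of A0]] by simp
  then have rlim: "r \<longlonglongrightarrow> 0"
    by (rule Lim_null_comparison[OF always_eventually, rotated]) (use rA in blast)
  then have R0: "R \<longlonglongrightarrow> 0"
    using bounded_linear.tendsto[OF bounded_linear_op_of rlim] by (simp add: R_def[abs_def] op_of_simps)
  have "(\<lambda>k. A k - R k) \<longlonglongrightarrow> 0 - 0" by (intro tendsto_diff A0 R0)
  then have S0: "S \<longlonglongrightarrow> 0" by (simp add: ASR)
  define l where "l k = norm (r k)" for k
  have l: "0 < l k" for k using r0 by (simp add: l_def)
  have l0: "l \<longlonglongrightarrow> 0" unfolding l_def[abs_def] using rlim by (rule tendsto_norm_zero)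
  define g where "g k = exp (- S k) * x k" for k
  have gG: "mat_of (g k) \<in> G" for k
  proof -
    have "mat_of (S k) \<in> lie_algebra G" using sr(1) by (simp add: S_def)
    then have "mat_of (exp ((-1) *\<^sub>R S k)) \<in> G" unfolding lie_algebra_iff by blast
    then show ?thesis unfolding g_def by (intro group_mult x(1)) simp
  qed
  obtain c where c: "\<And>a. norm (op_of a :: 'n matop) \<le> norm a * c"
    using bounded_linear.bounded[OF bounded_linear_op_of] by blast
  let ?\<rho> = "\<lambda>k. norm (S k) + norm (R k)"
  let ?e = "\<lambda>k. (norm (exp (- S k)) * (exp (?\<rho> k) - 1) + norm (exp (- S k) - 1)) * c"
  have gR: "norm ((g k - 1) /\<^sub>R l k - R k /\<^sub>R l k) \<le> ?e k" for k
  proof -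
    have e1: "norm (exp (S k + R k) - exp (S k) - R k) \<le> (exp (?\<rho> k) - 1) * norm (R k)"
      using exp_minus_id_lipschitz[of "S k + R k" "?\<rho> k" "S k"] norm_triangle_ineq[of "S k" "R k"]
      by (simp add: algebra_simps)
    have "exp (- S k) * exp (S k) = 1" using exp_minus_inverse[of "- S k"] by simp
    then have "g k - 1 - R k = exp (- S k) * (exp (S k + R k) - exp (S k) - R k) + (exp (- S k) - 1) * R k"
      using expA[of k] by (simp add: g_def ASR algebra_simps)
    also have "norm \<dots> \<le> norm (exp (- S k)) * norm (exp (S k + R k) - exp (S k) - R k)
        + norm (exp (- S k) - 1) * norm (R k)"
      by (intro order_trans[OF norm_triangle_ineq] add_mono norm_mult_ineq)
    also have "\<dots> \<le> norm (exp (- S k)) * ((exp (?\<rho> k) - 1) * norm (R k))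
        + norm (exp (- S k) - 1) * norm (R k)"
      by (intro add_mono mult_left_mono e1) auto
    also have "\<dots> = (norm (exp (- S k)) * (exp (?\<rho> k) - 1) + norm (exp (- S k) - 1)) * norm (R k)"
      by (simp add: algebra_simps)
    also have "\<dots> \<le> (norm (exp (- S k)) * (exp (?\<rho> k) - 1) + norm (exp (- S k) - 1)) * (l k * c)"
      using c[of "r k"] by (intro mult_left_mono add_nonneg_nonneg mult_nonneg_nonneg) (auto simp: R_def l_def)
    finally have "norm (g k - 1 - R k) \<le> l k * ?e k" by (simp add: mult_ac)
    then have "inverse (l k) * norm (g k - 1 - R k) \<le> inverse (l k) * (l k * ?e k)"
      using l[of k] by (intro mult_left_mono) auto
    moreover have "norm ((g k - 1) /\<^sub>R l k - R k /\<^sub>R l k) = inverse (l k) * norm (g k - 1 - R k)"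
      using l[of k] by (simp flip: scaleR_diff_right)
    moreover have "inverse (l k) * (l k * ?e k) = ?e k" using l[of k] by simp
    ultimately show ?thesis by simp
  qed
  have "?e \<longlonglongrightarrow> 0"
  proof -
    have "(\<lambda>k. - S k) \<longlonglongrightarrow> 0" using tendsto_minus[OF S0] by simp
    from tendsto_exp_algebra[OF this] have eS: "(\<lambda>k. exp (- S k)) \<longlonglongrightarrow> 1" by simp
    have "?e \<longlonglongrightarrow> (norm (1::'n matop) * (exp (norm (0::'n matop) + norm (0::'n matop)) - 1)
        + norm (1 - (1::'n matop))) * c"
      by (intro tendsto_intros eS S0 R0)
    then show ?thesis by simp
  qed
  then have diff0: "(\<lambda>k. (g k - 1) /\<^sub>R l k - R k /\<^sub>R l k) \<longlonglongrightarrow> 0"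
    by (rule Lim_null_comparison[OF always_eventually, rotated]) (use gR in blast)
  define q where "q k = r k /\<^sub>R l k" for k
  have "q k \<in> sphere 0 1" for k using l[of k] r0[of k] by (simp add: q_def l_def)
  then obtain p \<sigma> where p: "p \<in> sphere 0 1" "strict_mono \<sigma>" "(q \<circ> \<sigma>) \<longlonglongrightarrow> p"
    using compact_sphere[of "0 :: real ^ 'n ^ 'n" 1] unfolding compact_def by blast
  have "(\<lambda>k. op_of (q (\<sigma> k))) \<longlonglongrightarrow> op_of p"
    using bounded_linear.tendsto[OF bounded_linear_op_of p(3)] by (simp add: o_def)
  moreover have "op_of (q k) = R k /\<^sub>R l k" for k by (simp add: q_def R_def op_of_simps)
  ultimately have Rlim: "(\<lambda>k. R (\<sigma> k) /\<^sub>R l (\<sigma> k)) \<longlonglongrightarrow> op_of p" by simp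
  have "(\<lambda>k. (g (\<sigma> k) - 1) /\<^sub>R l (\<sigma> k)) \<longlonglongrightarrow> op_of p"
    using tendsto_add[OF LIMSEQ_subseq_LIMSEQ[OF diff0 p(2)] Rlim] by (simp add: o_def)
  moreover have "(\<lambda>k. l (\<sigma> k)) \<longlonglongrightarrow> 0"
    using LIMSEQ_subseq_LIMSEQ[OF l0 p(2)] by (simp add: o_def)
  ultimately have "mat_of (op_of p) \<in> lie_algebra G"
    by (intro lie_algebra_limit[of "\<lambda>k. g (\<sigma> k)" "\<lambda>k. l (\<sigma> k)"] gG l)
  then have "q k \<bullet> p = 0" for k using sr(2)[of p k] by (simp add: q_def)
  moreover have "(\<lambda>k. (q \<circ> \<sigma>) k \<bullet> p) \<longlonglongrightarrow> p \<bullet> p" by (intro tendsto_intros p(3))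
  ultimately have "p \<bullet> p = 0" by (simp add: LIMSEQ_const_iff)
  then show False using p(1) by simp
qed

end

section \<open>The error flow\<close>

text \<open>The function \<open>exp (- 2 K t) (D t \<bullet> D t)\<close> is nonincreasing.\<close>
lemma gronwall_zero:
  fixes D :: "real \<Rightarrow> 'a::real_inner"
  assumes cd: "c \<le> d"
    and der: "\<And>t. c \<le> t \<Longrightarrow> t \<le> d \<Longrightarrow> (D has_vector_derivative D' t) (at t within {c..d})"
    and bd: "\<And>t. c \<le> t \<Longrightarrow> t \<le> d \<Longrightarrow> norm (D' t) \<le> K * norm (D t)"
    and D0: "D c = 0"
  shows "D d = 0"
proof -
  let ?\<phi> = "\<lambda>t. exp (- 2 * K * t) * (D t \<bullet> D t)"
  let ?\<phi>' = "\<lambda>t. exp (- 2 * K * t) * (D t \<bullet> D' t + D' t \<bullet> D t) + - 2 * K * exp (- 2 * K * t) * (D t \<bullet> D t)"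
  have "(?\<phi> has_vector_derivative ?\<phi>' t) (at t within {c..d})" if t: "c \<le> t" "t \<le> d" for t
  proof -
    have "((\<lambda>t. exp (- 2 * K * t)) has_real_derivative - 2 * K * exp (- 2 * K * t)) (at t within {c..d})"
      by (auto intro!: derivative_eq_intros)
    then have "((\<lambda>t. exp (- 2 * K * t)) has_vector_derivative - 2 * K * exp (- 2 * K * t)) (at t within {c..d})"
      by (simp add: has_real_derivative_iff_has_vector_derivative)
    from has_vector_derivative_mult[OF this bounded_bilinear.has_vector_derivative[OF bounded_bilinear_inner der[OF t] der[OF t]]]
    show ?thesis .
  qed
  then obtain x where x: "x \<in> {c..d}" "?\<phi> d - ?\<phi> c = (d - c) *\<^sub>R ?\<phi>' x"
    using mvt_very_simple[OF cd, of ?\<phi> "\<lambda>t s. s *\<^sub>R ?\<phi>' t"] unfolding has_vector_derivative_def by blast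
  have "D x \<bullet> D' x \<le> K * (D x \<bullet> D x)"
  proof -
    have "D x \<bullet> D' x \<le> norm (D x) * norm (D' x)" by (rule norm_cauchy_schwarz)
    also have "\<dots> \<le> norm (D x) * (K * norm (D x))" using x bd by (intro mult_left_mono) auto
    finally show ?thesis by (simp add: dot_square_norm power2_eq_square mult_ac)
  qed
  then have "exp (- 2 * K * x) * (2 * (D x \<bullet> D' x) - 2 * (K * (D x \<bullet> D x))) \<le> 0"
    by (intro mult_nonneg_nonpos) auto
  moreover have "?\<phi>' x = exp (- 2 * K * x) * (2 * (D x \<bullet> D' x) - 2 * (K * (D x \<bullet> D x)))"
    by (simp add: inner_commute algebra_simps)
  ultimately have "?\<phi>' x \<le> 0" by simp
  then have "(d - c) *\<^sub>R ?\<phi>' x \<le> 0" using cd by (simp add: mult_nonneg_nonpos)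
  then have "?\<phi> d \<le> 0" using x(2) D0 by simp
  then have "D d \<bullet> D d \<le> 0" by (simp add: mult_le_0_iff)
  then show ?thesis by (metis inner_eq_zero_iff inner_ge_zero order_antisym)
qed

lemma error_field_lipschitz:
  fixes E F :: "'a::{real_normed_algebra_1,banach}"
  assumes E: "norm (1 - E) \<le> \<rho>" and F: "norm (1 - F) \<le> \<rho>" and \<rho>: "\<rho> < 1"
  shows "norm (E * log_one_minus (1 - E) - F * log_one_minus (1 - F)) \<le> 3 / (1 - \<rho>) * norm (E - F)"
proof -
  let ?L = "\<lambda>E. log_one_minus (1 - E)"
  have "norm E \<le> norm (1::'a) + norm (1 - E)"
    using norm_triangle_ineq4[of 1 "1 - E"] by simp
  then have nE: "norm E \<le> 2" using E \<rho> by simp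
  have d: "norm (?L E - ?L F) \<le> norm (E - F) / (1 - \<rho>)"
    using log_one_minus_lipschitz[OF E F \<rho>] by (simp add: norm_minus_commute)
  have "0 \<le> \<rho>" using E norm_ge_zero[of "1 - E"] by linarith
  then have "norm (?L F) \<le> norm (1 - F) / (1 - \<rho>)"
    using log_one_minus_lipschitz[OF F, of 0] \<rho> by simp
  also have "\<dots> \<le> 1 / (1 - \<rho>)" using F \<rho> by (intro divide_right_mono) auto
  finally have L: "norm (?L F) \<le> 1 / (1 - \<rho>)" .
  have "E * ?L E - F * ?L F = E * (?L E - ?L F) + (E - F) * ?L F" by (simp add: algebra_simps)
  also have "norm \<dots> \<le> norm E * norm (?L E - ?L F) + norm (E - F) * norm (?L F)"
    by (intro order_trans[OF norm_triangle_ineq] add_mono norm_mult_ineq)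
  also have "\<dots> \<le> 2 * (norm (E - F) / (1 - \<rho>)) + norm (E - F) * (1 / (1 - \<rho>))"
    by (intro add_mono mult_mono nE d L) auto
  finally show ?thesis by (simp add: add_divide_distrib[symmetric])
qed

text \<open>The first bound confines the error to its initial ball; the second, in which \<open>s\<close> will be
  \<open>exp (- a (t - t0))\<close>, is the rate of convergence.\<close>
lemma one_minus_powr_bounds:
  fixes r s :: real
  assumes r: "0 \<le> r" "r < 1" and s: "0 \<le> s" "s \<le> 1"
  shows "1 - (1 - r) powr s \<le> r" "1 - (1 - r) powr s \<le> s * (r / (1 - r))"
proof -
  have "(1 - r) powr 1 \<le> (1 - r) powr s" using r s by (intro powr_mono') auto
  then show "1 - (1 - r) powr s \<le> r" using r by simp
  have "ln (1 / (1 - r)) \<le> 1 / (1 - r) - 1" using r by (intro ln_le_minus_one) simp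
  also have "1 / (1 - r) - 1 = r / (1 - r)" using r by (simp add: field_simps)
  finally have "s * (- ln (1 - r)) \<le> s * (r / (1 - r))"
    using r s by (intro mult_left_mono) (simp_all add: ln_div)
  moreover have "1 + s * ln (1 - r) \<le> exp (s * ln (1 - r))" by (rule exp_ge_add_one_self)
  moreover have "(1 - r) powr s = exp (s * ln (1 - r))" using r by (simp add: powr_def)
  ultimately show "1 - (1 - r) powr s \<le> s * (r / (1 - r))" by linarith
qed

text \<open>This makes the exponent of the error flow its principal logarithm. It follows from uniqueness,
  as scaling by \<open>s \<le> 1\<close> does not move eigenvalues out of the strip.\<close>
lemma log_one_minus_exp_scaleR:
  fixes Z :: "'n::finite matop"
  assumes Z: "norm Z < 1" and s: "0 < s" "s \<le> 1"
  shows "log_one_minus (1 - exp (s *\<^sub>R log_one_minus Z)) = s *\<^sub>R log_one_minus Z"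
proof (rule principal_log_unique[symmetric])
  have "norm (1 - exp (s *\<^sub>R log_one_minus Z)) \<le> 1 - (1 - norm Z) powr s"
    using s by (intro norm_one_minus_power_le[OF Z]) auto
  also have "\<dots> \<le> norm Z" using one_minus_powr_bounds(1)[of "norm Z" s] Z s by simp
  finally show "norm (1 - exp (s *\<^sub>R log_one_minus Z)) < 1" using Z by simp
  show "eigenvalues (mat_of (s *\<^sub>R log_one_minus Z)) \<subseteq> principal_strip"
  proof
    fix z assume "z \<in> eigenvalues (mat_of (s *\<^sub>R log_one_minus Z))"
    then obtain v where v: "v \<noteq> 0" "complex_act (s *\<^sub>R log_one_minus Z) v = z *s v" unfolding eigenvalues_iff by blast
    have "complex_act (log_one_minus Z) v = (1 / s) *\<^sub>R (s *\<^sub>R complex_act (log_one_minus Z) v)" using s by simp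
    also have "s *\<^sub>R complex_act (log_one_minus Z) v = z *s v" using v(2) by (simp only: complex_act_simps)
    also have "(1 / s) *\<^sub>R (z *s v) = ((1 / s) *\<^sub>R z) *s v" by (simp add: vec_eq_iff)
    finally have "(1 / s) *\<^sub>R z \<in> principal_strip"
      using v(1) log_one_minus_eigenvalues[OF Z] eigenvalues_iff by blast
    then have w: "\<bar>Im z\<bar> / s < pi" using s by (auto simp: principal_strip_def abs_if field_simps)
    have "\<bar>Im z\<bar> * 1 \<le> \<bar>Im z\<bar> * (1 / s)" using s by (intro mult_left_mono) auto
    with w show "z \<in> principal_strip" by (auto simp: principal_strip_def)
  qed
qed simp

definition error_flow :: "real \<Rightarrow> real \<Rightarrow> 'a::{real_normed_algebra_1,banach} \<Rightarrow> real \<Rightarrow> 'a" where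
  "error_flow a t0 E0 t = exp (exp (- a * (t - t0)) *\<^sub>R log_one_minus (1 - E0))"

lemma error_flow_initial: "norm (1 - E0) < 1 \<Longrightarrow> error_flow a t0 E0 t0 = E0"
  by (simp add: error_flow_def exp_log_one_minus)

lemma error_flow_bounds:
  fixes E0 :: "'a::{real_normed_algebra_1,banach}"
  assumes E0: "norm (1 - E0) < 1" and a: "0 < a" and t: "t0 \<le> t"
  shows "norm (1 - error_flow a t0 E0 t) \<le> norm (1 - E0)"
    "norm (1 - error_flow a t0 E0 t) \<le> exp (- a * (t - t0)) * (norm (1 - E0) / (1 - norm (1 - E0)))"
proof -
  let ?s = "exp (- a * (t - t0))"
  have s: "0 \<le> ?s" "?s \<le> 1" using a t by auto
  have "norm (1 - error_flow a t0 E0 t) \<le> 1 - (1 - norm (1 - E0)) powr ?s"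
    unfolding error_flow_def by (rule norm_one_minus_power_le[OF E0 s])
  then show "norm (1 - error_flow a t0 E0 t) \<le> norm (1 - E0)"
    "norm (1 - error_flow a t0 E0 t) \<le> ?s * (norm (1 - E0) / (1 - norm (1 - E0)))"
    using one_minus_powr_bounds[OF norm_ge_zero E0 s] by linarith+
qed

lemma error_flow_derivative:
  fixes E0 :: "'n::finite matop"
  assumes E0: "norm (1 - E0) < 1" and a: "0 < a" and t: "t0 \<le> t"
  defines "E \<equiv> error_flow a t0 E0"
  shows "(E has_vector_derivative - (a *\<^sub>R (E t * log_one_minus (1 - E t)))) (at t within S)"
proof -
  let ?s = "\<lambda>t. exp (- a * (t - t0))" and ?L = "log_one_minus (1 - E0)"
  have L: "log_one_minus (1 - E t) = ?s t *\<^sub>R ?L"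
    unfolding E_def error_flow_def using a t by (intro log_one_minus_exp_scaleR[OF E0]) auto
  have "(?s has_real_derivative - a * ?s t) (at t)" by (auto intro!: derivative_eq_intros)
  then have "(?s has_vector_derivative - a * ?s t) (at t)"
    by (simp add: has_real_derivative_iff_has_vector_derivative)
  from vector_diff_chain_at[OF this exp_scaleR_has_vector_derivative_right[of ?L]]
  have "(E has_vector_derivative (- a * ?s t) *\<^sub>R (E t * ?L)) (at t)"
    by (simp add: E_def error_flow_def[abs_def] o_def)
  then show ?thesis by (simp add: L has_vector_derivative_at_within)
qed

text \<open>The differential equation is assumed only while \<open>Z\<close> is in the unit ball around 1, since the
  logarithm is not known to be regular elsewhere. Fix a radius \<open>\<rho>\<close> strictly between \<open>norm (1 - Z t0)\<close>
  and 1. Until \<open>Z\<close> first reaches that radius, the Lipschitz estimate makes it agree with the flow;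
  but the flow stays strictly inside, so the radius is never reached.\<close>
lemma error_flow_unique:
  fixes Z :: "real \<Rightarrow> 'n::finite matop"
  assumes a: "0 < a" and t: "t0 \<le> t" and Z0: "norm (1 - Z t0) < 1"
    and der: "\<And>s. t0 \<le> s \<Longrightarrow> s \<le> t \<Longrightarrow> (Z has_vector_derivative D s) (at s within {t0..t})"
    and D: "\<And>s. t0 \<le> s \<Longrightarrow> s \<le> t \<Longrightarrow> norm (1 - Z s) < 1 \<Longrightarrow> D s = - (a *\<^sub>R (Z s * log_one_minus (1 - Z s)))"
  shows "Z t = error_flow a t0 (Z t0) t"
proof -
  define r where "r = norm (1 - Z t0)"
  define \<rho> where "\<rho> = (1 + r) / 2"
  have \<rho>: "r < \<rho>" "\<rho> < 1" using Z0 by (auto simp: r_def \<rho>_def)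
  let ?E = "error_flow a t0 (Z t0)"
  have "bounded_linear (mat_of :: 'n matop \<Rightarrow> _)" by (rule bounded_linear_mat_of)
  then obtain c1 where c1: "0 < c1" "\<And>A :: 'n matop. norm (mat_of A) \<le> norm A * c1"
    using bounded_linear.pos_bounded by blast
  obtain c2 where c2: "\<And>A. norm (op_of A :: 'n matop) \<le> norm A * c2"
    using bounded_linear.bounded[OF bounded_linear_op_of] by blast
  have agree: "Z \<tau> = ?E \<tau>"
    if \<tau>: "t0 \<le> \<tau>" "\<tau> \<le> t" and le: "\<And>s. t0 \<le> s \<Longrightarrow> s \<le> \<tau> \<Longrightarrow> norm (1 - Z s) \<le> \<rho>" for \<tau>
  proof -
    let ?F = "\<lambda>E :: 'n matop. E * log_one_minus (1 - E)"
    let ?K = "3 / (1 - \<rho>)"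
    \<comment> \<open>The difference is measured in the Frobenius norm, which comes from an inner product;
      \<open>c1\<close> and \<open>c2\<close> compare it with the operator norm.\<close>
    let ?\<Delta> = "\<lambda>s. mat_of (Z s - ?E s)"
    have "?\<Delta> \<tau> = 0"
    proof (rule gronwall_zero[OF \<tau>(1), where K = "a * (?K * c2) * c1"])
      fix s assume s: "t0 \<le> s" "s \<le> \<tau>"
      have Zs: "norm (1 - Z s) \<le> \<rho>" by (rule le[OF s])
      have Es: "norm (1 - ?E s) \<le> \<rho>"
        using error_flow_bounds(1)[OF Z0 a s(1)] \<rho> by (simp add: r_def)
      have "(Z has_vector_derivative - (a *\<^sub>R ?F (Z s))) (at s within {t0..\<tau>})"
        using has_vector_derivative_within_subset[OF der[of s], of "{t0..\<tau>}"] s \<tau> D[of s] Zs \<rho>(2) by simp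
      from has_vector_derivative_diff[OF this error_flow_derivative[OF Z0 a s(1)]]
      have "((\<lambda>s. Z s - ?E s) has_vector_derivative - (a *\<^sub>R (?F (Z s) - ?F (?E s)))) (at s within {t0..\<tau>})"
        by (simp add: algebra_simps)
      from bounded_linear.has_vector_derivative[OF bounded_linear_mat_of this]
      show "(?\<Delta> has_vector_derivative mat_of (- (a *\<^sub>R (?F (Z s) - ?F (?E s))))) (at s within {t0..\<tau>})" .
      have "norm (mat_of (- (a *\<^sub>R (?F (Z s) - ?F (?E s))))) \<le> norm (- (a *\<^sub>R (?F (Z s) - ?F (?E s)))) * c1"
        by (rule c1(2))
      also have "norm (- (a *\<^sub>R (?F (Z s) - ?F (?E s)))) = a * norm (?F (Z s) - ?F (?E s))"
        using a by (simp del: mat_of_simps)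
      also have "\<dots> * c1 \<le> a * (?K * norm (Z s - ?E s)) * c1"
        using a c1 by (intro mult_right_mono mult_left_mono error_field_lipschitz[OF Zs Es \<rho>(2)]) auto
      also have "\<dots> \<le> a * (?K * (norm (?\<Delta> s) * c2)) * c1"
        using a c1(1) \<rho>(2) c2[of "?\<Delta> s"] by (intro mult_right_mono mult_left_mono) (simp_all del: mat_of_simps)
      finally show "norm (mat_of (- (a *\<^sub>R (?F (Z s) - ?F (?E s))))) \<le> a * (?K * c2) * c1 * norm (?\<Delta> s)"
        by (simp only: mult_ac)
    next
      show "?\<Delta> t0 = 0" using error_flow_initial[OF Z0] by simp
    qed
    then show ?thesis by (simp add: matop_eq_iff)
  qed
  have cont: "continuous_on {t0..t} (\<lambda>s. norm (1 - Z s))"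
  proof -
    have "continuous_on {t0..t} Z"
      unfolding continuous_on_eq_continuous_within using has_vector_derivative_continuous[OF der] by auto
    then show ?thesis by (intro continuous_intros)
  qed
  have hit: "\<exists>s'\<ge>t0. s' \<le> s \<and> norm (1 - Z s') = \<rho>" if "t0 \<le> s" "s \<le> t" "\<rho> \<le> norm (1 - Z s)" for s
    using IVT'[of "\<lambda>s. norm (1 - Z s)" t0 \<rho> s] that \<rho>(1) continuous_on_subset[OF cont, of "{t0..s}"]
    by (auto simp: r_def)
  let ?H = "{s \<in> {t0..t}. norm (1 - Z s) = \<rho>}"
  have "?H = {}"
  proof (rule ccontr)
    assume ne: "?H \<noteq> {}"
    have "closed ?H" by (intro continuous_closed_preimage_constant cont) simp
    moreover have "bounded ?H" by (rule bounded_subset[of "{t0..t}"]) auto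
    ultimately have "compact ?H" by (simp only: compact_eq_bounded_closed)
    from compact_attains_inf[OF this ne] obtain \<tau>
      where \<tau>: "\<tau> \<in> ?H" "\<And>s. s \<in> ?H \<Longrightarrow> \<tau> \<le> s"
      by blast
    have "norm (1 - Z s) \<le> \<rho>" if s: "t0 \<le> s" "s \<le> \<tau>" for s
    proof (rule ccontr)
      assume "\<not> norm (1 - Z s) \<le> \<rho>"
      then have gt: "\<rho> < norm (1 - Z s)" by simp
      then obtain s' where s': "t0 \<le> s'" "s' \<le> s" "norm (1 - Z s') = \<rho>"
        using hit[of s] s \<tau>(1) by auto
      then have "\<tau> \<le> s'" using \<tau> s by auto
      then have "s' = s" using s s' by simp
      then show False using gt s' by simp
    qed
    then have "Z \<tau> = ?E \<tau>" using \<tau>(1) by (intro agree) auto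
    then have "norm (1 - Z \<tau>) \<le> r"
      using error_flow_bounds(1)[OF Z0 a, of t0 \<tau>] \<tau>(1) by (simp add: r_def)
    then show False using \<tau>(1) \<rho>(1) by simp
  qed
  have "norm (1 - Z s) \<le> \<rho>" if s: "t0 \<le> s" "s \<le> t" for s
  proof (rule ccontr)
    assume "\<not> norm (1 - Z s) \<le> \<rho>"
    then obtain s' where "t0 \<le> s'" "s' \<le> s" "norm (1 - Z s') = \<rho>"
      using hit[OF s] by auto
    then have "s' \<in> ?H" using s by simp
    then show False using \<open>?H = {}\<close> by blast
  qed
  then show ?thesis using t by (intro agree) auto
qed

section \<open>Conjugation and inverses\<close>

lemma conj_power:
  fixes a p q :: "'a::monoid_mult"
  assumes "p * q = 1" "q * p = 1"
  shows "(q * a * p) ^ k = q * a ^ k * p"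
proof (induction k)
  case (Suc k)
  have "(q * a * p) ^ Suc k = (q * a * p) * (q * a ^ k * p)" by (simp only: power_Suc Suc.IH)
  also have "\<dots> = q * (a * ((p * q) * (a ^ k * p)))" by (simp only: mult.assoc)
  finally show ?case by (simp add: assms mult.assoc)
qed (simp add: assms)

lemma exp_conj:
  fixes a p q :: "'a::{real_normed_algebra_1,banach}"
  assumes "p * q = 1" "q * p = 1"
  shows "exp (q * a * p) = q * exp a * p"
proof -
  have "(\<lambda>k. q * (a ^ k /\<^sub>R fact k) * p) sums (q * exp a * p)"
    by (intro sums_mult sums_mult2 exp_converges)
  then have "(\<lambda>k. (q * a * p) ^ k /\<^sub>R fact k) sums (q * exp a * p)"
    by (simp add: conj_power[OF assms])
  then show ?thesis using exp_converges sums_unique2 by blast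
qed

lemma eigenvalues_conj:
  fixes a p q :: "'n::finite matop"
  assumes pq: "p * q = 1" "q * p = 1"
  shows "eigenvalues (mat_of (q * a * p)) \<subseteq> eigenvalues (mat_of a)"
proof
  fix z assume "z \<in> eigenvalues (mat_of (q * a * p))"
  then obtain v where v: "v \<noteq> 0" "complex_act (q * a * p) v = z *s v" unfolding eigenvalues_iff by blast
  have "complex_act q (complex_act p v) = v" using pq(2) complex_act_simps(6) by (metis complex_act_mult)
  then have "complex_act p v \<noteq> 0" using v(1) complex_act_simps(8) by metis
  moreover have "complex_act a (complex_act p v) = z *s complex_act p v"
  proof -
    have "complex_act a (complex_act p v) = complex_act (p * q) (complex_act a (complex_act p v))" by (simp add: pq complex_act_simps)
    also have "\<dots> = complex_act p (complex_act (q * a * p) v)" by (simp add: complex_act_mult)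
    finally show ?thesis by (simp add: v(2) complex_act_simps)
  qed
  ultimately show "z \<in> eigenvalues (mat_of a)" unfolding eigenvalues_iff by blast
qed

text \<open>Only conjugates of points of the unit ball around 1 are considered: such a conjugate may leave
  the ball, but its principal logarithm is still unique because conjugating back is possible.\<close>
lemma mlog_conj:
  fixes x p q :: "'n::finite matop"
  assumes pq: "p * q = 1" "q * p = 1" and x: "norm (1 - x) < 1"
  shows "mlog (mat_of (q * x * p)) = mat_of (q * log_one_minus (1 - x) * p)"
    "mat_of (q * x * p) \<in> mlog_domain"
proof -
  let ?L = "log_one_minus (1 - x)"
  show "mlog (mat_of (q * x * p)) = mat_of (q * ?L * p)"
    unfolding mlog_def
  proof (rule the_equality)
    have "exp (q * ?L * p) = q * x * p" by (simp add: exp_conj[OF pq] exp_log_one_minus[OF x])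
    moreover have "eigenvalues (mat_of (q * ?L * p)) \<subseteq> principal_strip"
      using eigenvalues_conj[OF pq] log_one_minus_eigenvalues[OF x] by blast
    ultimately show "mexp (mat_of (q * ?L * p)) = mat_of (q * x * p) \<and>
        (\<forall>z\<in>eigenvalues (mat_of (q * ?L * p)). - pi < Im z \<and> Im z < pi)"
      by (auto simp: mexp_mat_of principal_strip_def simp del: mat_of_simps)
  next
    fix B assume B: "mexp B = mat_of (q * x * p) \<and> (\<forall>z\<in>eigenvalues B. - pi < Im z \<and> Im z < pi)"
    define b where "b = op_of B"
    have eb: "exp b = q * x * p" using B by (simp add: b_def mexp_eq_exp matop_eq_iff)
    have "exp (p * b * q) = p * exp b * q" by (rule exp_conj[OF pq(2,1)])
    also have "\<dots> = (p * q) * x * (p * q)" by (simp only: eb mult.assoc)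
    finally have "exp (p * b * q) = 1 - (1 - x)" by (simp add: pq)
    moreover have "eigenvalues (mat_of (p * b * q)) \<subseteq> principal_strip"
      using eigenvalues_conj[OF pq(2,1), of b] B by (auto simp: b_def principal_strip_def simp del: mat_of_simps)
    ultimately have "p * b * q = ?L" by (rule principal_log_unique[OF x])
    then have "q * ?L * p = q * (p * b * q) * p" by (simp only:)
    also have "\<dots> = (q * p) * b * (q * p)" by (simp only: mult.assoc)
    finally show "B = mat_of (q * ?L * p)" by (simp add: pq b_def del: mat_of_simps)
  qed
  have "z \<notin> \<real>\<^sub>\<le>\<^sub>0" if z: "z \<in> eigenvalues (mat_of (q * x * p))" for z
  proof -
    obtain v where v: "v \<noteq> 0" "complex_act x v = z *s v"
      using z eigenvalues_conj[OF pq] eigenvalues_iff by blast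
    have "complex_act (1 - x) v = (1 - z) *s v" by (simp add: complex_act_simps v vector_sub_rdistrib)
    then have "cmod (1 - z) < 1" using eigenvalue_norm_le[OF v(1)] x by (meson le_less_trans)
    then have "0 < Re z" using complex_Re_le_cmod[of "1 - z"] by simp
    then show ?thesis by (auto simp: complex_nonpos_Reals_iff)
  qed
  then show "mat_of (q * x * p) \<in> mlog_domain" unfolding mlog_domain_def by blast
qed

text \<open>From \<open>y s - y t = - y s (x s - x t) y t\<close>, once \<open>y\<close> is known to be continuous; the same identity
  first bounds \<open>y s\<close> by twice the norm of \<open>y t\<close> for \<open>s\<close> near \<open>t\<close>.\<close>
lemma has_vector_derivative_inverse:
  fixes x y :: "real \<Rightarrow> 'a::{real_normed_algebra_1,banach}"
  assumes der: "(x has_vector_derivative D) (at t within S)"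
    and xy: "\<And>s. x s * y s = 1" and yx: "\<And>s. y s * x s = 1"
  shows "(y has_vector_derivative - (y t * D * y t)) (at t within S)"
proof -
  have diff: "y s - y t = - (y s * (x s - x t) * y t)" for s
    using yx[of s] xy[of t] by (simp add: algebra_simps)
  have xlim: "(x \<longlongrightarrow> x t) (at t within S)"
    using has_vector_derivative_continuous[OF der] by (simp add: continuous_within)
  have ylim: "(y \<longlongrightarrow> y t) (at t within S)"
  proof -
    define c where "c = norm (y t)"
    have x0: "((\<lambda>s. norm (x s - x t)) \<longlongrightarrow> 0) (at t within S)"
      using xlim by (intro tendsto_norm_zero LIM_zero)
    from tendsto_mult_left_zero[OF this, of c]
    have "\<forall>\<^sub>F s in at t within S. norm (x s - x t) * c < 1 / 2" by (rule order_tendstoD) simp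
    then have "\<forall>\<^sub>F s in at t within S. norm (y s - y t) \<le> norm (x s - x t) * (2 * c * c)"
    proof eventually_elim
      case (elim s)
      have "norm (y s - y t) \<le> norm (y s * (x s - x t)) * c"
        unfolding diff norm_minus_cancel c_def by (rule norm_mult_ineq)
      also have "\<dots> \<le> norm (y s) * norm (x s - x t) * c"
        by (intro mult_right_mono norm_mult_ineq) (simp add: c_def)
      finally have *: "norm (y s - y t) \<le> norm (y s) * (norm (x s - x t) * c)" by (simp add: mult.assoc)
      also have "\<dots> \<le> norm (y s) * (1 / 2)" using elim by (intro mult_left_mono) auto
      finally have "norm (y s) \<le> 2 * c"
        using norm_triangle_ineq2[of "y s" "y t"] by (simp add: c_def)
      then have "norm (y s) * (norm (x s - x t) * c) \<le> 2 * c * (norm (x s - x t) * c)"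
        by (intro mult_right_mono) (auto simp: c_def)
      with * show ?case by (simp add: mult_ac)
    qed
    from Lim_null_comparison[OF this tendsto_mult_left_zero[OF x0]]
    show ?thesis by (rule LIM_zero_cancel)
  qed
  have "((\<lambda>s. - (y s * ((x s - x t) /\<^sub>R (s - t)) * y t)) \<longlongrightarrow> - (y t * D * y t)) (at t within S)"
    using der unfolding has_vector_derivative_iff_Lim by (intro tendsto_intros ylim)
  moreover have "(y s - y t) /\<^sub>R (s - t) = - (y s * ((x s - x t) /\<^sub>R (s - t)) * y t)" for s
    by (simp add: diff)
  ultimately show ?thesis unfolding has_vector_derivative_iff_Lim by (simp only:)
qed

section \<open>Observer and error trajectories\<close>

lemma plant_solution_inverse:
  fixes X :: "real \<Rightarrow> real ^ 'n::finite ^ 'n"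
  assumes G: "linear_lie_group G" and X: "plant_solution G u X"
  shows "op_of (X t) * op_of (matrix_inv (X t)) = 1" "op_of (matrix_inv (X t)) * op_of (X t) = 1"
proof -
  have "X t \<in> G" using X by (simp add: plant_solution_def)
  moreover have "closedin (top_of_set {A. invertible A}) G" using G by (simp add: linear_lie_group_def)
  then have "G \<subseteq> {A. invertible A}" by (rule closedin_imp_subset)
  ultimately have "invertible (X t)" by blast
  then have "X t ** matrix_inv (X t) = mat 1 \<and> matrix_inv (X t) ** X t = mat 1"
    unfolding matrix_inv_def invertible_def by (rule someI_ex)
  then show "op_of (X t) * op_of (matrix_inv (X t)) = 1" "op_of (matrix_inv (X t)) * op_of (X t) = 1"
    by (simp_all add: matop_eq_iff)
qed

context
  fixes G :: "(real ^ 'n::finite ^ 'n) set" and u X :: "real \<Rightarrow> real ^ 'n ^ 'n" and a :: real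
  assumes G: "linear_lie_group G" and X: "plant_solution G u X" and a: "0 < a"
begin

abbreviation "xop t \<equiv> op_of (X t)"
abbreviation "yop t \<equiv> op_of (matrix_inv (X t))"
abbreviation "uop t \<equiv> op_of (u t)"

lemmas xy = plant_solution_inverse[OF G X]

lemma plant_op_derivative:
  "(xop has_vector_derivative xop t * uop t) (at t within S)"
  "(yop has_vector_derivative - (uop t * yop t)) (at t within S)"
proof -
  have "(X has_vector_derivative X t ** u t) (at t within S)"
    using X by (simp add: plant_solution_def has_vector_derivative_at_within)
  from bounded_linear.has_vector_derivative[OF bounded_linear_op_of this]
  show x: "(xop has_vector_derivative xop t * uop t) (at t within S)" by (simp add: op_of_simps)
  have "yop t * (xop t * uop t) * yop t = (yop t * xop t) * (uop t * yop t)"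
    by (simp only: mult.assoc)
  then have "yop t * (xop t * uop t) * yop t = uop t * yop t" by (simp only: xy mult_1_left)
  with has_vector_derivative_inverse[OF x xy]
  show "(yop has_vector_derivative - (uop t * yop t)) (at t within S)" by (simp only:)
qed

lemma mlog_output:
  assumes E: "norm (1 - E) < 1"
  shows "matrix_inv (X t) ** mat_of (E * xop t) \<in> mlog_domain"
    "mlog (matrix_inv (X t) ** mat_of (E * xop t)) = mat_of (yop t * log_one_minus (1 - E) * xop t)"
proof -
  have "matrix_inv (X t) ** mat_of (E * xop t) = mat_of (yop t * E * xop t)"
    by (simp add: matrix_mul_assoc)
  then show "matrix_inv (X t) ** mat_of (E * xop t) \<in> mlog_domain"
    "mlog (matrix_inv (X t) ** mat_of (E * xop t)) = mat_of (yop t * log_one_minus (1 - E) * xop t)"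
    using mlog_conj[OF xy E] by (simp_all only:)
qed

lemma observer_solution_of_error:
  assumes E: "\<And>t. t \<in> J \<Longrightarrow> norm (1 - E t) < 1"
    and der: "\<And>t. t \<in> J \<Longrightarrow> (E has_vector_derivative - (a *\<^sub>R (E t * log_one_minus (1 - E t)))) (at t within J)"
  shows "observer_solution a u X J (\<lambda>t. mat_of (E t * xop t))"
  unfolding observer_solution_def
proof (intro ballI conjI)
  fix t assume t: "t \<in> J"
  show "matrix_inv (X t) ** mat_of (E t * xop t) \<in> mlog_domain" by (rule mlog_output(1)[OF E[OF t]])
  let ?L = "log_one_minus (1 - E t)"
  have eq: "E t * xop t * (yop t * ?L * xop t) = E t * ?L * xop t"
  proof -
    have "E t * xop t * (yop t * ?L * xop t) = E t * (xop t * yop t) * (?L * xop t)"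
      by (simp only: mult.assoc)
    then show ?thesis by (simp only: xy mult_1_right mult.assoc)
  qed
  have "((\<lambda>t. E t * xop t) has_vector_derivative
      E t * (xop t * uop t) + - (a *\<^sub>R (E t * ?L)) * xop t) (at t within J)"
    by (intro has_vector_derivative_mult der t plant_op_derivative)
  moreover have "E t * (xop t * uop t) + - (a *\<^sub>R (E t * ?L)) * xop t =
      E t * xop t * uop t - a *\<^sub>R (E t * xop t * (yop t * ?L * xop t))"
    unfolding eq by (simp add: mult.assoc)
  ultimately have "((\<lambda>t. E t * xop t) has_vector_derivative
      E t * xop t * uop t - a *\<^sub>R (E t * xop t * (yop t * ?L * xop t))) (at t within J)"
    by (simp only:)
  from bounded_linear.has_vector_derivative[OF bounded_linear_mat_of this]
  show "((\<lambda>t. mat_of (E t * xop t)) has_vector_derivative mat_of (E t * xop t) ** u t -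
      a *\<^sub>R (mat_of (E t * xop t) ** mlog (matrix_inv (X t) ** mat_of (E t * xop t)))) (at t within J)"
    unfolding mlog_output(2)[OF E[OF t]] by simp
qed

text \<open>The right-invariant error of any observer solution solves the error equation while it is
  in the unit ball around 1, because there \<open>mlog (X\<^sup>-\<^sup>1 Xh) = X\<^sup>-\<^sup>1 log (E) X\<close>.\<close>
lemma observer_solution_unique:
  assumes sol: "observer_solution a u X J Xh" and J: "is_interval J" "t0 \<in> J" "J \<subseteq> {t0..}"
    and E0: "norm (1 - op_of (Xh t0) * yop t0) < 1" and t: "t \<in> J"
  shows "op_of (Xh t) * yop t = error_flow a t0 (op_of (Xh t0) * yop t0) t"
proof -
  let ?Z = "\<lambda>t. op_of (Xh t) * yop t"
  let ?M = "\<lambda>s. op_of (mlog (matrix_inv (X s) ** Xh s))"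
  have t0t: "t0 \<le> t" using J t by auto
  have sub: "{t0..t} \<subseteq> J"
  proof
    fix s assume "s \<in> {t0..t}"
    then show "s \<in> J" using mem_is_interval_1_I[OF J(1,2) t, of s] by simp
  qed
  show ?thesis
  proof (rule error_flow_unique[where Z = ?Z, OF a t0t E0, where D = "\<lambda>s. - (a *\<^sub>R (op_of (Xh s) * ?M s * yop s))"])
    fix s assume s: "t0 \<le> s" "s \<le> t"
    have "s \<in> J" using sub s by auto
    then have "(Xh has_vector_derivative
        Xh s ** u s - a *\<^sub>R (Xh s ** mlog (matrix_inv (X s) ** Xh s))) (at s within J)"
      using sol by (simp add: observer_solution_def)
    then have "(Xh has_vector_derivative
        Xh s ** u s - a *\<^sub>R (Xh s ** mlog (matrix_inv (X s) ** Xh s))) (at s within {t0..t})"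
      by (rule has_vector_derivative_within_subset[OF _ sub])
    from bounded_linear.has_vector_derivative[OF bounded_linear_op_of this]
    have "((\<lambda>s. op_of (Xh s)) has_vector_derivative
        op_of (Xh s) * uop s - a *\<^sub>R (op_of (Xh s) * ?M s)) (at s within {t0..t})"
      by (simp add: op_of_simps)
    from has_vector_derivative_mult[OF this plant_op_derivative(2)]
    have "(?Z has_vector_derivative op_of (Xh s) * - (uop s * yop s) +
        (op_of (Xh s) * uop s - a *\<^sub>R (op_of (Xh s) * ?M s)) * yop s) (at s within {t0..t})" .
    moreover have "op_of (Xh s) * - (uop s * yop s) +
        (op_of (Xh s) * uop s - a *\<^sub>R (op_of (Xh s) * ?M s)) * yop s
        = - (a *\<^sub>R (op_of (Xh s) * ?M s * yop s))"
      by (simp add: left_diff_distrib mult.assoc)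
    ultimately show "(?Z has_vector_derivative - (a *\<^sub>R (op_of (Xh s) * ?M s * yop s))) (at s within {t0..t})"
      by (simp only:)
    assume Z: "norm (1 - ?Z s) < 1"
    have Xh: "mat_of (?Z s * xop s) = Xh s"
    proof -
      have "?Z s * xop s = op_of (Xh s) * (yop s * xop s)" by (simp only: mult.assoc)
      then have "?Z s * xop s = op_of (Xh s)" by (simp only: xy mult_1_right)
      then show ?thesis by (simp only: mat_of_op)
    qed
    have "?M s = yop s * log_one_minus (1 - ?Z s) * xop s"
      using mlog_output(2)[OF Z, of s] unfolding Xh by (simp only: op_of_mat)
    then have "op_of (Xh s) * ?M s * yop s = ?Z s * log_one_minus (1 - ?Z s) * (xop s * yop s)"
      by (simp only: mult.assoc)
    then show "- (a *\<^sub>R (op_of (Xh s) * ?M s * yop s)) = - (a *\<^sub>R (?Z s * log_one_minus (1 - ?Z s)))"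
      by (simp only: xy mult_1_right)
  qed
qed

lemma unique_observer_solution:
  assumes E0: "norm (1 - op_of Xh0 * yop t0) < 1"
  shows "unique_solution_from (observer_solution a u X) t0
    (\<lambda>t. mat_of (error_flow a t0 (op_of Xh0 * yop t0) t * xop t))"
    (is "unique_solution_from _ _ ?Xh")
  unfolding unique_solution_from_def
proof (intro conjI allI impI ballI)
  let ?E = "error_flow a t0 (op_of Xh0 * yop t0)"
  have ball: "norm (1 - ?E t) < 1" if "t0 \<le> t" for t
    using error_flow_bounds(1)[OF E0 a that] E0 by simp
  show "observer_solution a u X {t0..} ?Xh"
    by (intro observer_solution_of_error error_flow_derivative[OF E0 a]) (use ball in auto)
  fix J Xh t
  assume *: "is_interval J \<and> t0 \<in> J \<and> J \<subseteq> {t0..} \<and> observer_solution a u X J Xh \<and> Xh t0 = ?Xh t0"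
    and t: "t \<in> J"
  have cancel: "op_of A * yop s * xop s = op_of A" for A s
    by (simp only: mult.assoc xy mult_1_right)
  have "op_of (Xh t0) = op_of Xh0"
    using * by (simp only: error_flow_initial[OF E0] cancel op_of_mat mat_of_op)
  then have eq: "op_of (Xh t) * yop t = ?E t"
    using observer_solution_unique[of J Xh t0 t] * t E0 by (simp only:)
  show "Xh t = ?Xh t"
    by (simp only: eq[symmetric] cancel mat_of_op)
qed

lemma unique_error_solution:
  assumes E0: "norm (1 - E0) < 1"
  shows "unique_solution_from (error_solution a u X) t0 (\<lambda>t. mat_of (error_flow a t0 E0 t))"
  unfolding unique_solution_from_def
proof (intro conjI allI impI ballI)
  let ?E = "error_flow a t0 E0"
  have ball: "norm (1 - ?E t) < 1" if "t0 \<le> t" for t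
    using error_flow_bounds(1)[OF E0 a that] E0 by simp
  have "observer_solution a u X {t0..} (\<lambda>t. mat_of (?E t * xop t))"
    by (intro observer_solution_of_error error_flow_derivative[OF E0 a]) (use ball in auto)
  moreover have inv: "mat_of (?E t) = mat_of (?E t * xop t) ** matrix_inv (X t)" for t
  proof -
    have "?E t = ?E t * xop t * yop t" by (simp only: mult.assoc xy mult_1_right)
    then have "mat_of (?E t) = mat_of (?E t * xop t * yop t)" by (rule arg_cong)
    then show ?thesis by simp
  qed
  ultimately show "error_solution a u X {t0..} (\<lambda>t. mat_of (?E t))"
    unfolding error_solution_def
    by (intro exI[of _ "\<lambda>t. mat_of (?E t * xop t)"] conjI ballI inv)
  fix J Z t
  assume *: "is_interval J \<and> t0 \<in> J \<and> J \<subseteq> {t0..} \<and> error_solution a u X J Z \<and> Z t0 = mat_of (?E t0)"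
    and t: "t \<in> J"
  then obtain Xh where Xh: "observer_solution a u X J Xh" "\<And>s. s \<in> J \<Longrightarrow> Z s = Xh s ** matrix_inv (X s)"
    unfolding error_solution_def by blast
  have op: "op_of (Z s) = op_of (Xh s) * yop s" if "s \<in> J" for s
    using Xh(2)[OF that] by (simp add: op_of_simps)
  have "op_of (Z t0) = E0" using * by (simp only: error_flow_initial[OF E0] op_of_mat)
  then have "op_of (Xh t0) * yop t0 = E0" using op[of t0] * by (simp only:)
  then have "op_of (Xh t) * yop t = ?E t"
    using observer_solution_unique[OF Xh(1), of t0 t] * t E0 by (simp only:)
  then have "op_of (Z t) = ?E t" by (simp only: op[OF t])
  then show "Z t = mat_of (?E t)" by (simp add: matop_eq_iff)
qed

lemma error_solution_identity: "error_solution a u X {0..} (\<lambda>_. mat 1)"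
proof -
  have "error_flow a 0 1 = (\<lambda>_. 1 :: 'n matop)" by (simp add: error_flow_def fun_eq_iff)
  then show ?thesis
    using unique_error_solution[of 1 0] by (simp add: unique_solution_from_def)
qed

end

theorem mainTheorem1:
  fixes G :: "(real ^ 'n ^ 'n) set" and u :: "real \<Rightarrow> real ^ 'n ^ 'n" and a0 :: real
  assumes "linear_lie_group G"
    and "\<forall>t. u t \<in> lie_algebra G"
    and "admissible G u"
    and "a0 > 0"
  shows "exponentially_stabilizes_error G a0 u (opball (mat 1) 1) (mat 1) \<and>
    ((\<forall>X. plant_solution G u X \<longrightarrow> bounded (X ` {0..})) \<longrightarrow>
      (\<forall>X0\<in>G. \<exists>\<epsilon>>0. \<forall>X. plant_solution G u X \<and> X 0 = X0 \<longrightarrow>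
        (\<forall>Xh0\<in>G. opnorm (Xh0 - X0) < \<epsilon> \<longrightarrow>
          (\<exists>Xh. Xh 0 = Xh0 \<and> unique_solution_from (observer_solution a0 u X) 0 Xh \<and>
             (\<forall>t\<ge>0. Xh t \<in> G) \<and> converges_exponentially Xh X))))"
proof (intro conjI impI)
  note G = assms(1) and a = assms(4)
  have ball: "norm (1 - op_of E0) < r" if "E0 \<in> opball (mat 1) r" for E0 :: "real ^ 'n ^ 'n" and r
    using that by (simp add: opball_def norm_matop_def)
  have dist: "opnorm (mat_of E - mat 1) = norm (1 - E)" for E :: "'n matop"
    by (subst norm_minus_commute) (simp add: norm_matop_def)
  show "exponentially_stabilizes_error G a0 u (opball (mat 1) 1) (mat 1)"
    unfolding exponentially_stabilizes_error_def error_locally_exp_stable_def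
  proof (intro conjI allI impI ballI)
    fix X assume X: "plant_solution G u X"
    show "error_solution a0 u X {0..} (\<lambda>_. mat 1)" by (rule error_solution_identity[OF G X a])
  next
    have main: "\<exists>E. E t0 = E0 \<and> unique_solution_from (error_solution a0 u X) t0 E \<and>
        (\<forall>t\<ge>t0. opnorm (E t - mat 1) \<le> 2 * exp (- a0 * (t - t0)) * opnorm (E0 - mat 1))"
      if X: "plant_solution G u X" and E0: "E0 \<in> opball (mat 1) (1 / 2)" for X t0 E0
    proof (intro exI[of _ "\<lambda>t. mat_of (error_flow a0 t0 (op_of E0) t)"] conjI allI impI)
      have E: "norm (1 - op_of E0) < 1" "norm (1 - op_of E0) < 1 / 2" using ball[OF E0] by auto
      show "mat_of (error_flow a0 t0 (op_of E0) t0) = E0" by (simp add: error_flow_initial[OF E(1)])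
      show "unique_solution_from (error_solution a0 u X) t0 (\<lambda>t. mat_of (error_flow a0 t0 (op_of E0) t))"
        by (rule unique_error_solution[OF G X a E(1)])
      fix t assume t: "t0 \<le> t"
      let ?r = "norm (1 - op_of E0)"
      have "?r * 1 \<le> ?r * (2 * (1 - ?r))" using E(2) by (intro mult_left_mono) auto
      then have "?r \<le> 2 * ?r * (1 - ?r)" by (simp add: algebra_simps)
      then have "?r / (1 - ?r) \<le> 2 * ?r" using E(1) by (simp add: pos_divide_le_eq)
      then have "exp (- a0 * (t - t0)) * (?r / (1 - ?r)) \<le> exp (- a0 * (t - t0)) * (2 * ?r)"
        by (intro mult_left_mono) auto
      with error_flow_bounds(2)[OF E(1) a t]
      show "opnorm (mat_of (error_flow a0 t0 (op_of E0) t) - mat 1) \<le>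
          2 * exp (- a0 * (t - t0)) * opnorm (E0 - mat 1)"
        using dist[of "op_of E0"] by (simp add: dist)
    qed
    show "\<exists>\<delta>>0. \<exists>m>0. \<exists>\<alpha>>0. \<forall>X. plant_solution G u X \<longrightarrow>
        (\<forall>t0\<ge>0. \<forall>E0\<in>opball (mat 1) \<delta>. \<exists>E. E t0 = E0 \<and>
           unique_solution_from (error_solution a0 u X) t0 E \<and>
           (\<forall>t\<ge>t0. opnorm (E t - mat 1) \<le> m * exp (- \<alpha> * (t - t0)) * opnorm (E0 - mat 1)))"
      by (rule exI[of _ "1 / 2"], rule conjI, simp, rule exI[of _ 2], rule conjI, simp,
          rule exI[of _ a0]) (use a main in blast)
  next
    fix X and E0 :: "real ^ 'n ^ 'n"
    assume X: "plant_solution G u X" and E0: "E0 \<in> opball (mat 1) 1"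
    show "\<exists>E. E 0 = E0 \<and> unique_solution_from (error_solution a0 u X) 0 E \<and>
        converges_exponentially E (\<lambda>_. mat 1)"
    proof (intro exI[of _ "\<lambda>t. mat_of (error_flow a0 0 (op_of E0) t)"] conjI)
      note E = ball[OF E0]
      let ?r = "norm (1 - op_of E0)"
      show "mat_of (error_flow a0 0 (op_of E0) 0) = E0" by (simp add: error_flow_initial[OF E])
      show "unique_solution_from (error_solution a0 u X) 0 (\<lambda>t. mat_of (error_flow a0 0 (op_of E0) t))"
        by (rule unique_error_solution[OF G X a E])
      have "0 \<le> ?r / (1 - ?r)" using E by simp
      moreover have "opnorm (mat_of (error_flow a0 0 (op_of E0) t) - mat 1)
          \<le> (?r / (1 - ?r) + 1) * exp (- a0 * t)" if "0 \<le> t" for t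
      proof -
        have "exp (- a0 * (t - 0)) * (?r / (1 - ?r)) \<le> exp (- a0 * (t - 0)) * (?r / (1 - ?r) + 1)"
          by (intro mult_left_mono) auto
        with error_flow_bounds(2)[OF E a that] show ?thesis unfolding dist by (simp add: mult.commute)
      qed
      ultimately show "converges_exponentially (\<lambda>t. mat_of (error_flow a0 0 (op_of E0) t)) (\<lambda>_. mat 1)"
        unfolding converges_exponentially_def using a
        by (intro exI[of _ "?r / (1 - ?r) + 1"] exI[of _ a0] conjI) auto
    qed
  qed
  assume bdd: "\<forall>X. plant_solution G u X \<longrightarrow> bounded (X ` {0..})"
  show "\<forall>X0\<in>G. \<exists>\<epsilon>>0. \<forall>X. plant_solution G u X \<and> X 0 = X0 \<longrightarrow>
      (\<forall>Xh0\<in>G. opnorm (Xh0 - X0) < \<epsilon> \<longrightarrow>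
        (\<exists>Xh. Xh 0 = Xh0 \<and> unique_solution_from (observer_solution a0 u X) 0 Xh \<and>
           (\<forall>t\<ge>0. Xh t \<in> G) \<and> converges_exponentially Xh X))"
  proof
    fix X0 assume X0: "X0 \<in> G"
    obtain \<delta> where \<delta>: "0 < \<delta>"
      "\<And>x. mat_of x \<in> G \<Longrightarrow> norm (1 - x) < \<delta> \<Longrightarrow> mat_of (log_one_minus (1 - x)) \<in> lie_algebra G"
      using log_in_lie_algebra[OF G] by blast
    let ?y = "op_of (matrix_inv X0)"
    \<comment> \<open>The error is \<open>E0 = 1 + (Xh0 - X0) X0\<^sup>-\<^sup>1\<close>; it must be in the unit ball for the flow and
      \<open>\<delta>\<close>-close to 1 for its logarithm to be in the Lie algebra. Adding 1 keeps the divisor positive.\<close>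
    define \<epsilon> where "\<epsilon> = min \<delta> 1 / (norm ?y + 1)"
    have ny: "0 < norm ?y + 1" using norm_ge_zero[of ?y] by linarith
    have \<epsilon>: "0 < \<epsilon>" using \<delta>(1) ny by (simp add: \<epsilon>_def)
    have "\<exists>Xh. Xh 0 = Xh0 \<and> unique_solution_from (observer_solution a0 u X) 0 Xh \<and>
           (\<forall>t\<ge>0. Xh t \<in> G) \<and> converges_exponentially Xh X"
      if X: "plant_solution G u X" "X 0 = X0" and Xh0: "Xh0 \<in> G" "opnorm (Xh0 - X0) < \<epsilon>" for X Xh0
    proof -
      let ?x = "\<lambda>t. op_of (X t)"
      note inv = plant_solution_inverse[OF G X(1)]
      have xG: "mat_of (?x t) \<in> G" for t using X(1) by (simp add: plant_solution_def)
      define E0 where "E0 = op_of Xh0 * ?y"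
      have "1 - E0 = - (op_of (Xh0 - X0) * ?y)"
        using inv(1)[of 0] by (simp add: E0_def X(2) op_of_simps left_diff_distrib)
      then have "norm (1 - E0) \<le> norm (op_of (Xh0 - X0)) * norm ?y"
        using norm_mult_ineq[of "op_of (Xh0 - X0)" ?y] by (simp only: norm_minus_cancel)
      also have "\<dots> \<le> norm (op_of (Xh0 - X0)) * (norm ?y + 1)" by (intro mult_left_mono) auto
      also have "\<dots> < \<epsilon> * (norm ?y + 1)"
        using Xh0(2) ny by (intro mult_strict_right_mono) (simp_all add: norm_op_of)
      also have "\<dots> = min \<delta> 1" using ny by (simp add: \<epsilon>_def)
      finally have E0: "norm (1 - E0) < 1" "norm (1 - E0) < \<delta>" by auto
      let ?E = "error_flow a0 0 E0"
      let ?r = "norm (1 - E0)"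
      have "mat_of E0 \<in> G"
        using G Xh0(1) X0 by (simp add: E0_def linear_lie_group_def)
      then have EG: "mat_of (?E t) \<in> G" for t
        using \<delta>(2)[of E0] E0(2) by (simp add: error_flow_def lie_algebra_iff)
      have y0: "?y = op_of (matrix_inv (X 0))" by (simp add: X(2))
      have "E0 * ?x 0 = op_of Xh0 * (?y * ?x 0)" by (simp only: E0_def mult.assoc)
      then have E0x: "E0 * ?x 0 = op_of Xh0" unfolding y0 by (simp only: inv mult_1_right)
      have "bounded (X ` {0..})" using bdd X(1) by blast
      then have "bounded (op_of ` X ` {0..} :: 'n matop set)"
        by (rule bounded_linear_image[OF _ bounded_linear_op_of])
      then obtain M where M: "0 < M" "\<And>t. 0 \<le> t \<Longrightarrow> norm (?x t) \<le> M"
        unfolding bounded_pos by auto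
      show ?thesis
      proof (intro exI[of _ "\<lambda>t. mat_of (?E t * ?x t)"] conjI allI impI)
        show "mat_of (?E 0 * ?x 0) = Xh0"
          unfolding error_flow_initial[OF E0(1)] E0x by simp
        show "unique_solution_from (observer_solution a0 u X) 0 (\<lambda>t. mat_of (?E t * ?x t))"
          using unique_observer_solution[OF G X(1) a, of Xh0 0] E0(1) by (simp only: E0_def y0)
        show "mat_of (?E t * ?x t) \<in> G" for t by (rule group_mult[OF G EG xG])
        have r: "0 \<le> ?r / (1 - ?r)" using E0 by simp
        have "opnorm (mat_of (?E t * ?x t) - X t) \<le> ((?r / (1 - ?r) + 1) * M) * exp (- a0 * t)" if t: "0 \<le> t" for t
        proof -
          have "opnorm (mat_of (?E t * ?x t) - X t) = norm ((?E t - 1) * ?x t)"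
            by (simp add: norm_matop_def left_diff_distrib)
          also have "\<dots> \<le> norm (1 - ?E t) * norm (?x t)"
            using norm_mult_ineq[of "?E t - 1" "?x t"] by (simp only: norm_minus_commute)
          also have "\<dots> \<le> (exp (- a0 * (t - 0)) * (?r / (1 - ?r) + 1)) * M"
          proof (intro mult_mono M(2) t)
            have "exp (- a0 * (t - 0)) * (?r / (1 - ?r)) \<le> exp (- a0 * (t - 0)) * (?r / (1 - ?r) + 1)"
            by (intro mult_left_mono) auto
            with error_flow_bounds(2)[OF E0(1) a t]
            show "norm (1 - ?E t) \<le> exp (- a0 * (t - 0)) * (?r / (1 - ?r) + 1)" by (rule order_trans)
          qed (use r in auto)
          finally show ?thesis by (simp only: mult_ac diff_zero)
        qed
        then show "converges_exponentially (\<lambda>t. mat_of (?E t * ?x t)) X"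
          unfolding converges_exponentially_def using a r M(1)
          by (intro exI[of _ "(?r / (1 - ?r) + 1) * M"] exI[of _ a0] conjI) (auto intro!: mult_pos_pos)
      qed
    qed
    then show "\<exists>\<epsilon>>0. \<forall>X. plant_solution G u X \<and> X 0 = X0 \<longrightarrow>
      (\<forall>Xh0\<in>G. opnorm (Xh0 - X0) < \<epsilon> \<longrightarrow>
        (\<exists>Xh. Xh 0 = Xh0 \<and> unique_solution_from (observer_solution a0 u X) 0 Xh \<and>
           (\<forall>t\<ge>0. Xh t \<in> G) \<and> converges_exponentially Xh X))"
      using \<epsilon> by (intro exI[of _ \<epsilon>]) blast
  qed
qed

end
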